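(* Let $0<r<n\le 2r$ be integers, let $\alpha,\beta\in\mathbb{C}$, $C\in M_{r,n-r}$, $D\in M_{n-r,r}$, and let $$A=\begin{bmatrix}\alpha I_r & C\\ D&\beta I_{n-r}\end{bmatrix}\in M_n .$$ Suppose that $Z=DC$ is normal and commutes with $H=C^*C+DD^*$, and let $z_j$ and $h_j$, $j=1,\dots,n-r$, be the eigenvalues of $Z$ and $H$ labeled according to a simultaneous unitary diagonalization: there is a unitary $U\in M_{n-r}$ with $U^*ZU=\mathrm{diag}(z_1,\dots,z_{n-r})$ and $U^*HU=\mathrm{diag}(h_1,\dots,h_{n-r})$. For $j=1,\dots,n-r$ let $\Delta_j=(\alpha-\beta)^2+4z_j$ and let $\mathcal E_j$ be the closed elliptical disc bounded by the ellipse with foci at $\frac12(\alpha+\beta)\pm\frac12\sqrt{\Delta_j}$ and with major and minor axes of length $$\sqrt{\tfrac12|\alpha-\beta|^2+h_j+\tfrac12|\Delta_j|}\qquad\text{and}\qquad \sqrt{\tfrac12|\alpha-\beta|^2+h_j-\tfrac12|\Delta_j|},$$ respectively. If $\mathcal E_{n-r}\subseteq\cdots\subseteq\mathcal E_1$, then $$\Lambda_k(A)=\mathcal E_k,\qquad 1\le k\le n-r .$$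
   Context: $M_{m,n}$ is the set of $m\times n$ complex matrices and $M_n=M_{n,n}$. For $A\in M_n$ and $1\le k\le n$, the rank-$k$ numerical range is $$\Lambda_k(A)=\{\lambda\in\mathbb{C}: X^*AX=\lambda I_k \text{ for some } X\in M_{n,k}\text{ with }X^*X=I_k\}.$$ "Length of the major/minor axis" is the full length of the axis. Elliptical discs may be degenerate: if the minor axis has length $0$, the disc is the line segment joining the foci (a single point if the foci coincide). *)

theory Defs
  imports "Jordan_Normal_Form.Schur_Decomposition"
begin

definition unitary_mat :: "nat \<Rightarrow> complex mat \<Rightarrow> bool" where
  "unitary_mat n U \<longleftrightarrow>
     U \<in> carrier_mat n n \<and> mat_adjoint U * U = 1\<^sub>m n \<and> U * mat_adjoint U = 1\<^sub>m n"

definition normal_mat :: "complex mat \<Rightarrow> bool" where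
  "normal_mat Z \<longleftrightarrow> square_mat Z \<and> mat_adjoint Z * Z = Z * mat_adjoint Z"

definition rank_numerical_range :: "nat \<Rightarrow> complex mat \<Rightarrow> complex set" where
  "rank_numerical_range k A =
     {\<mu>. \<exists>X \<in> carrier_mat (dim_row A) k.
           mat_adjoint X * X = 1\<^sub>m k \<and> mat_adjoint X * A * X = \<mu> \<cdot>\<^sub>m 1\<^sub>m k}"

text \<open>The closed elliptical disc with foci \<open>p\<close>, \<open>q\<close> and (full) major and minor axis lengths
  \<open>a\<close>, \<open>b\<close>: the image of the closed unit disc under scaling by the semi-axes, rotation of the
  real axis onto the line through the foci, and translation to the centre.  If \<open>b = 0\<close> this is
  a segment.  The data describe an actual ellipse only if \<open>a\<^sup>2 = b\<^sup>2 + (dist p q)\<^sup>2\<close>, and then the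
  set is the usual one given by the sum of the distances to the foci; see
  \<open>elliptical_disc_eq_foci\<close>.\<close>

definition elliptical_disc :: "complex \<Rightarrow> complex \<Rightarrow> real \<Rightarrow> real \<Rightarrow> complex set" where
  "elliptical_disc p q a b =
     (let u = (if p = q then 1 else sgn (p - q))
      in {(p + q) / 2 + u * Complex (a / 2 * Re s) (b / 2 * Im s) | s. norm s \<le> 1})"

lemma elliptical_disc_centred:
  fixes f A B x y :: real
  assumes nn: "0 \<le> f" "0 \<le> A" "0 \<le> B" and ax: "A\<^sup>2 = B\<^sup>2 + f\<^sup>2"
  shows "cmod (Complex x y - of_real f) + cmod (Complex x y + of_real f) \<le> 2 * A \<longleftrightarrow>
    (\<exists>s. norm s \<le> 1 \<and> Complex x y = Complex (A * Re s) (B * Im s))" (is "?d1 + ?d2 \<le> _ \<longleftrightarrow> _")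
proof
  have fA: "f \<le> A"
    using ax nn by (smt (verit) power2_le_imp_le zero_le_power2)
  have B2: "B\<^sup>2 = A\<^sup>2 - f\<^sup>2" using ax by simp
  have d1: "?d1\<^sup>2 = (x - f)\<^sup>2 + y\<^sup>2" and d2: "?d2\<^sup>2 = (x + f)\<^sup>2 + y\<^sup>2"
    by (simp_all add: cmod_power2)
  {
    assume "\<exists>s. norm s \<le> 1 \<and> Complex x y = Complex (A * Re s) (B * Im s)"
    then obtain s where s: "norm s \<le> 1" and x: "x = A * Re s" and y: "y = B * Im s" by auto
    define X Y where "X = Re s" and "Y = Im s"
    have XY: "X\<^sup>2 + Y\<^sup>2 \<le> 1"
      using power_mono[OF s, of 2] by (simp add: cmod_power2 X_def Y_def)
    have X1: "\<bar>X\<bar> \<le> 1" using s abs_Re_le_cmod[of s] by (simp add: X_def)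
    then have fX: "\<bar>f * X\<bar> \<le> A"
      using fA nn(1) by (metis abs_mult abs_of_nonneg mult_left_le order_trans)
    have B: "B\<^sup>2 * Y\<^sup>2 \<le> B\<^sup>2 * (1 - X\<^sup>2)" using XY by (intro mult_left_mono) auto
    have "(A * X - f)\<^sup>2 + (B * Y)\<^sup>2 \<le> (A * X - f)\<^sup>2 + B\<^sup>2 * (1 - X\<^sup>2)"
      using B by (simp add: power_mult_distrib)
    also have "\<dots> = (A - f * X)\<^sup>2" unfolding B2 by (simp add: power2_eq_square algebra_simps)
    finally have "?d1\<^sup>2 \<le> (A - f * X)\<^sup>2"
      unfolding d1 unfolding x y X_def Y_def .
    moreover have "0 \<le> A - f * X" using fX by linarith
    ultimately have d1_le: "?d1 \<le> A - f * X" by (rule power2_le_imp_le)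
    have "(A * X + f)\<^sup>2 + (B * Y)\<^sup>2 \<le> (A * X + f)\<^sup>2 + B\<^sup>2 * (1 - X\<^sup>2)"
      using B by (simp add: power_mult_distrib)
    also have "\<dots> = (A + f * X)\<^sup>2" unfolding B2 by (simp add: power2_eq_square algebra_simps)
    finally have "?d2\<^sup>2 \<le> (A + f * X)\<^sup>2"
      unfolding d2 unfolding x y X_def Y_def .
    moreover have "0 \<le> A + f * X" using fX by linarith
    ultimately have d2_le: "?d2 \<le> A + f * X" by (rule power2_le_imp_le)
    show "?d1 + ?d2 \<le> 2 * A" using d1_le d2_le by linarith
  next
    assume le: "?d1 + ?d2 \<le> 2 * A"
    define S where "S = x\<^sup>2 + y\<^sup>2 + f\<^sup>2"
    have SS: "?d1\<^sup>2 + ?d2\<^sup>2 = 2 * S" unfolding d1 d2 S_def by (simp add: power2_eq_square algebra_simps)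
    have "(?d1 + ?d2)\<^sup>2 \<le> (2 * A)\<^sup>2" using le by (intro power_mono) auto
    then have "?d1 * ?d2 \<le> 2 * A\<^sup>2 - S"
      using SS by (simp add: power2_sum power_mult_distrib)
    then have "(?d1 * ?d2)\<^sup>2 \<le> (2 * A\<^sup>2 - S)\<^sup>2" by (intro power_mono) auto
    moreover have "(?d1 * ?d2)\<^sup>2 = S\<^sup>2 - 4 * f\<^sup>2 * x\<^sup>2"
      unfolding power_mult_distrib d1 d2 S_def by (simp add: power2_eq_square algebra_simps)
    ultimately have "S\<^sup>2 - 4 * f\<^sup>2 * x\<^sup>2 \<le> (2 * A\<^sup>2 - S)\<^sup>2" by simp
    moreover have "(2 * A\<^sup>2 - S)\<^sup>2 - (S\<^sup>2 - 4 * f\<^sup>2 * x\<^sup>2) = 4 * (A\<^sup>2 * B\<^sup>2 - (B\<^sup>2 * x\<^sup>2 + A\<^sup>2 * y\<^sup>2))"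
      unfolding S_def B2 by (simp add: power2_eq_square algebra_simps)
    ultimately have "0 \<le> 4 * (A\<^sup>2 * B\<^sup>2 - (B\<^sup>2 * x\<^sup>2 + A\<^sup>2 * y\<^sup>2))"
      by (metis diff_ge_0_iff_ge)
    then have key: "B\<^sup>2 * x\<^sup>2 + A\<^sup>2 * y\<^sup>2 \<le> A\<^sup>2 * B\<^sup>2" by simp
    have "2 * \<bar>x\<bar> \<le> ?d1 + ?d2"
      using abs_Re_le_cmod[of "Complex x y - of_real f"] abs_Re_le_cmod[of "Complex x y + of_real f"]
      by simp
    then have xA: "\<bar>x\<bar> \<le> A" using le by simp
    consider "A = 0" | "A > 0" "B = 0" | "A > 0" "B > 0" using nn by fastforce
    then show "\<exists>s. norm s \<le> 1 \<and> Complex x y = Complex (A * Re s) (B * Im s)"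
    proof cases
      case 1
      then have f0: "f = 0" using fA nn(1) by simp
      with 1 le have "Complex x y = 0" by simp
      with 1 f0 ax show ?thesis by (intro exI[of _ 0]) (auto simp: complex_eq_iff)
    next
      case 2
      then have "y = 0" using key by (simp add: mult_le_0_iff)
      with 2 xA show ?thesis
        by (intro exI[of _ "of_real (x / A)"]) (auto simp: field_simps norm_divide)
    next
      case 3
      then have "(x / A)\<^sup>2 + (y / B)\<^sup>2 \<le> 1"
        using key by (simp add: power_divide field_simps)
      with 3 show ?thesis
        by (intro exI[of _ "Complex (x / A) (y / B)"]) (auto simp: cmod_def)
    qed
  }
qed

lemma elliptical_disc_eq_foci:
  assumes nn: "0 \<le> a" "0 \<le> b" and ax: "a\<^sup>2 = b\<^sup>2 + (dist p q)\<^sup>2"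
  shows "elliptical_disc p q a b = {w. dist w p + dist w q \<le> a}"
proof (rule Set.set_eqI)
  fix w
  define u where "u = (if p = q then 1 else sgn (p - q))"
  define c where "c = (p + q) / 2"
  define f where "f = dist p q / 2"
  have u: "cmod u = 1" by (simp add: u_def norm_sgn)
  have uf: "u * of_real f = (p - q) / 2"
    by (simp add: u_def f_def dist_norm sgn_div_norm scaleR_conv_of_real field_simps)
  have p: "p = c + u * of_real f" and q: "q = c - u * of_real f"
    unfolding uf c_def by (simp_all add: field_simps)
  define v where "v = (w - c) / u"
  have u0: "u \<noteq> 0" using u by auto
  then have w: "w = c + u * v" by (simp add: v_def)
  have "dist w p = cmod (u * (v - of_real f))" "dist w q = cmod (u * (v + of_real f))"
    unfolding dist_norm by (simp_all add: w p q algebra_simps)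
  then have d: "dist w p = cmod (v - of_real f)" "dist w q = cmod (v + of_real f)"
    by (simp_all add: norm_mult u)
  have ax': "(a / 2)\<^sup>2 = (b / 2)\<^sup>2 + f\<^sup>2" using ax by (simp add: f_def power_divide)
  have "w \<in> elliptical_disc p q a b \<longleftrightarrow>
      (\<exists>s. norm s \<le> 1 \<and> v = Complex (a / 2 * Re s) (b / 2 * Im s))"
    unfolding elliptical_disc_def Let_def u_def[symmetric] c_def[symmetric]
    using u0 by (auto simp: w)
  also have "\<dots> \<longleftrightarrow> dist w p + dist w q \<le> a"
    using elliptical_disc_centred[of f "a / 2" "b / 2" "Re v" "Im v"] nn ax'
    by (simp add: d f_def)
  finally show "w \<in> elliptical_disc p q a b \<longleftrightarrow> w \<in> {w. dist w p + dist w q \<le> a}" by simp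
qed

end

theory Submission
  imports Defs
begin

text \<open>
  Put $a = \alpha - \mu$ and $b = \beta - \mu$. Both inclusions rest on the criterion
  $\mu \in \mathcal{E}_j \iff 2|ab - z_j| + 2\,\mathrm{Re}(a \bar b) \le h_j$,
  which is the focal description of the disc, because the foci are the roots of
  $\mu \mapsto ab - z_j$.

  If $\mu \in \mathcal{E}_k$ and $a \ne 0$, the columns of $W = (aD^* - \bar a C)U$ are
  orthogonal, so $W = F\,\mathrm{diag}(\nu_j)$ with $F^*F = I$ (here $n - r \le r$ is used).
  On the vectors $(p_j F e_j - a^{-1} C U e_j,\; U e_j)$ the sesquilinear form of $A - \mu$
  is diagonal, with entries $a|p_j|^2 + \nu_j p_j/\bar a - z_j/a + b$; the criterion says
  exactly that $p_j$ can be chosen to make the $j$-th entry vanish. This gives a $k$-dimensional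
  totally isotropic subspace. If $a = 0$, the first $r$ coordinate vectors span one.

  If $\mu \notin \mathcal{E}_k$, some unit $\epsilon$ makes the support function of
  $\mathcal{E}_k - \mu$ negative in the direction $\bar\epsilon$, and by nestedness that of every
  $\mathcal{E}_j - \mu$ with $j \ge k$ as well. Hence the Hermitian part of $\epsilon(A - \mu)$ is
  negative definite on a subspace of codimension $k - 1$, which meets every $k$-dimensional
  subspace nontrivially.
\<close>

subsection \<open>The elliptical discs\<close>

text \<open>The product of the distances from \<mu> to the foci is
  \<open>cmod ((\<alpha> - \<mu>) * (\<beta> - \<mu>) - z)\<close>, and the parallelogram law gives
  the sum of their squares, so squaring the focal inequality yields the criterion. The bound
  \<open>2 * cmod z \<le> h\<close> keeps both radicands nonnegative, as
  \<open>elliptical_disc_eq_foci\<close> requires.\<close>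

lemma elliptical_disc_mem_iff:
  fixes \<alpha> \<beta> z \<mu> \<Delta> :: complex and h :: real
  assumes \<Delta>: "\<Delta> = (\<alpha> - \<beta>)\<^sup>2 + 4 * z" and zh: "2 * cmod z \<le> h"
  shows "\<mu> \<in> elliptical_disc ((\<alpha> + \<beta>) / 2 + csqrt \<Delta> / 2) ((\<alpha> + \<beta>) / 2 - csqrt \<Delta> / 2)
           (sqrt ((cmod (\<alpha> - \<beta>))\<^sup>2 / 2 + h + cmod \<Delta> / 2))
           (sqrt ((cmod (\<alpha> - \<beta>))\<^sup>2 / 2 + h - cmod \<Delta> / 2)) \<longleftrightarrow>
         2 * cmod ((\<alpha> - \<mu>) * (\<beta> - \<mu>) - z) + 2 * Re ((\<alpha> - \<mu>) * cnj (\<beta> - \<mu>)) \<le> h"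
    (is "\<mu> \<in> elliptical_disc ?p ?q ?a ?b \<longleftrightarrow> _")
proof -
  have "cmod \<Delta> \<le> (cmod (\<alpha> - \<beta>))\<^sup>2 + 4 * cmod z"
    using norm_triangle_ineq[of "(\<alpha> - \<beta>)\<^sup>2" "4 * z"] by (simp add: \<Delta> norm_mult norm_power)
  then have rad: "0 \<le> (cmod (\<alpha> - \<beta>))\<^sup>2 / 2 + h - cmod \<Delta> / 2" using zh by simp
  then have rad': "0 \<le> (cmod (\<alpha> - \<beta>))\<^sup>2 / 2 + h + cmod \<Delta> / 2"
    using norm_ge_zero[of \<Delta>] by linarith
  have pq: "?p - ?q = csqrt \<Delta>" by (simp add: field_simps)
  have dpq: "(dist ?p ?q)\<^sup>2 = cmod \<Delta>"
    unfolding dist_norm pq by (metis norm_power power2_csqrt)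
  have "?a\<^sup>2 = ?b\<^sup>2 + (dist ?p ?q)\<^sup>2" unfolding dpq using rad rad' by simp
  then have disc: "elliptical_disc ?p ?q ?a ?b = {w. dist w ?p + dist w ?q \<le> ?a}"
    using rad rad' by (intro elliptical_disc_eq_foci) auto
  define d where "d = (\<alpha> - \<mu>) * (\<beta> - \<mu>) - z"
  define m where "m = \<mu> - (\<alpha> + \<beta>) / 2"
  define s where "s = csqrt \<Delta> / 2"
  have s2: "4 * s\<^sup>2 = (\<alpha> - \<beta>)\<^sup>2 + 4 * z" by (simp add: s_def power_divide \<Delta>)
  have dd: "dist \<mu> ?p = cmod (m - s)" "dist \<mu> ?q = cmod (m + s)"
    by (simp_all add: dist_norm m_def s_def algebra_simps)
  have m2: "2 * m = 2 * \<mu> - \<alpha> - \<beta>" by (simp add: m_def field_simps)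
  have "4 * d = 4 * ((m - s) * (m + s))"
  proof -
    have "4 * ((m - s) * (m + s)) = (2 * m)\<^sup>2 - 4 * s\<^sup>2"
      by (simp add: power2_eq_square algebra_simps)
    also have "\<dots> = 4 * d" unfolding m2 s2 d_def by (simp add: power2_eq_square algebra_simps)
    finally show ?thesis by simp
  qed
  then have prod: "cmod d = cmod (m - s) * cmod (m + s)" by (simp add: norm_mult)
  have sq: "(cmod (m - s))\<^sup>2 + (cmod (m + s))\<^sup>2 = 2 * (cmod m)\<^sup>2 + 2 * (cmod s)\<^sup>2"
    unfolding cmod_power2 by (simp add: power2_eq_square algebra_simps)
  have s2': "4 * (cmod s)\<^sup>2 = cmod \<Delta>"
    by (simp add: s_def norm_divide power_divide flip: norm_power)
  \<comment> \<open>With e = (\<alpha> - \<beta>) / 2 the two factors are e - m and - e - m, so the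
    mixed terms of the product are purely imaginary.\<close>
  have re: "2 * Re ((\<alpha> - \<mu>) * cnj (\<beta> - \<mu>)) = 2 * (cmod m)\<^sup>2 - (cmod (\<alpha> - \<beta>))\<^sup>2 / 2"
    unfolding cmod_power2 m_def by (simp add: power2_eq_square field_simps)
  have "cmod (m - s) + cmod (m + s) \<le> ?a \<longleftrightarrow> (cmod (m - s) + cmod (m + s))\<^sup>2 \<le> ?a\<^sup>2"
    by (meson add_nonneg_nonneg norm_ge_zero power2_le_imp_le power_mono rad' real_sqrt_ge_zero)
  also have "\<dots> \<longleftrightarrow> 2 * cmod d + 2 * Re ((\<alpha> - \<mu>) * cnj (\<beta> - \<mu>)) \<le> h"
    using rad' s2' sq unfolding re prod by (simp add: power2_sum) linarith
  finally show ?thesis unfolding disc d_def[symmetric] by (simp add: dd)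
qed

text \<open>The identity 2 Re u Re v = Re (u v) + Re (u cnj v) at u = \<epsilon> x, v = \<epsilon>
  y, where \<epsilon> drops out of the last term because it has modulus 1. It links the membership
  criterion with products of real parts in a fixed direction.\<close>

lemma Re_unit_square:
  assumes "cmod \<epsilon> = 1"
  shows "2 * Re (\<epsilon> * x) * Re (\<epsilon> * y) = Re (\<epsilon>\<^sup>2 * (x * y)) + Re (x * cnj y)"
proof -
  have "(Re \<epsilon>)\<^sup>2 + (Im \<epsilon>)\<^sup>2 = 1" using assms by (simp add: cmod_def)
  moreover have "2 * Re (\<epsilon> * x) * Re (\<epsilon> * y) - Re (\<epsilon>\<^sup>2 * (x * y))
      = ((Re \<epsilon>)\<^sup>2 + (Im \<epsilon>)\<^sup>2) * Re (x * cnj y)"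
    by (simp add: power2_eq_square algebra_simps)
  ultimately show ?thesis by simp
qed

text \<open>A linear functional on the unit disc is largest at the unit vector along its coefficient
  vector, where it equals the length of that vector. Hence the displayed value is the support
  function of the disc, moved to the origin, in the direction \<open>cnj \<epsilon>\<close>; only
  its attainment is recorded.\<close>

lemma elliptical_disc_support_point:
  fixes \<alpha> \<beta> z \<Delta> \<epsilon> :: complex and h :: real
  assumes \<Delta>: "\<Delta> = (\<alpha> - \<beta>)\<^sup>2 + 4 * z" and zh: "2 * cmod z \<le> h" and \<epsilon>: "cmod \<epsilon> = 1"
  shows "\<exists>w \<in> elliptical_disc ((\<alpha> + \<beta>) / 2 + csqrt \<Delta> / 2) ((\<alpha> + \<beta>) / 2 - csqrt \<Delta> / 2)
           (sqrt ((cmod (\<alpha> - \<beta>))\<^sup>2 / 2 + h + cmod \<Delta> / 2))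
           (sqrt ((cmod (\<alpha> - \<beta>))\<^sup>2 / 2 + h - cmod \<Delta> / 2)).
         Re (\<epsilon> * (w - (\<alpha> + \<beta>) / 2)) = sqrt ((Re (\<epsilon> * (\<alpha> - \<beta>)))\<^sup>2 + h + 2 * Re (\<epsilon>\<^sup>2 * z)) / 2"
    (is "\<exists>w \<in> elliptical_disc ?p ?q ?a ?b. _ = sqrt ?R / 2")
proof -
  have "cmod \<Delta> \<le> (cmod (\<alpha> - \<beta>))\<^sup>2 + 4 * cmod z"
    using norm_triangle_ineq[of "(\<alpha> - \<beta>)\<^sup>2" "4 * z"] by (simp add: \<Delta> norm_mult norm_power)
  then have rad: "0 \<le> (cmod (\<alpha> - \<beta>))\<^sup>2 / 2 + h - cmod \<Delta> / 2" using zh by simp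
  then have rad': "0 \<le> (cmod (\<alpha> - \<beta>))\<^sup>2 / 2 + h + cmod \<Delta> / 2"
    using norm_ge_zero[of \<Delta>] by linarith
  define u where "u = (if ?p = ?q then 1 else sgn (?p - ?q))"
  have pq: "?p - ?q = csqrt \<Delta>" by (simp add: field_simps)
  have u: "cmod u = 1" by (simp add: u_def norm_sgn)
  have "u * of_real (cmod (csqrt \<Delta>)) = csqrt \<Delta>"
    using pq by (auto simp: u_def sgn_div_norm scaleR_conv_of_real)
  then have "(u * of_real (cmod (csqrt \<Delta>)))\<^sup>2 = \<Delta>" by simp
  moreover have "(cmod (csqrt \<Delta>))\<^sup>2 = cmod \<Delta>" by (metis norm_power power2_csqrt)
  ultimately have u\<Delta>: "u\<^sup>2 * of_real (cmod \<Delta>) = \<Delta>"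
    by (simp add: power_mult_distrib flip: of_real_power)
  define e where "e = \<epsilon> * u"
  have "cmod e = 1" using u \<epsilon> by (simp add: e_def norm_mult)
  then have e: "(Re e)\<^sup>2 + (Im e)\<^sup>2 = 1" using cmod_power2[of e] by simp
  \<comment> \<open>In the coordinate s the functional is (x Re s + y Im s) / 2. The witness s below
    is (x, y) normalised; if \<rho> = 0, division by zero turns it into 0, which also works.\<close>
  define x y where "x = ?a * Re e" and "y = - ?b * Im e"
  define \<rho> where "\<rho> = sqrt (x\<^sup>2 + y\<^sup>2)"
  define s where "s = Complex (x / \<rho>) (y / \<rho>)"
  have \<rho>2: "\<rho>\<^sup>2 = x\<^sup>2 + y\<^sup>2" by (simp add: \<rho>_def)
  have s1: "cmod s \<le> 1"
  proof (cases "\<rho> = 0")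
    case False
    then have "(cmod s)\<^sup>2 = 1" by (simp add: s_def cmod_power2 power_divide flip: add_divide_distrib \<rho>2)
    then show ?thesis using power2_eq_1_iff[of "cmod s"] norm_ge_zero[of s] by linarith
  qed (simp add: s_def cmod_def)
  define w where "w = (?p + ?q) / 2 + u * Complex (?a / 2 * Re s) (?b / 2 * Im s)"
  have mem: "w \<in> elliptical_disc ?p ?q ?a ?b"
    using s1 unfolding elliptical_disc_def Let_def u_def[symmetric] w_def by blast
  have mid: "(?p + ?q) / 2 = (\<alpha> + \<beta>) / 2" by (simp add: field_simps)
  have "Re (\<epsilon> * (w - (\<alpha> + \<beta>) / 2)) = Re (e * Complex (?a / 2 * Re s) (?b / 2 * Im s))"
    unfolding w_def mid by (simp add: e_def mult.assoc)
  also have "\<dots> = (x * Re s + y * Im s) / 2" by (simp add: x_def y_def field_simps)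
  also have "x * Re s + y * Im s = \<rho>"
  proof (cases "\<rho> = 0")
    case False
    then show ?thesis using \<rho>2 by (simp add: s_def field_simps power2_eq_square)
  qed (simp add: s_def)
  finally have val: "Re (\<epsilon> * (w - (\<alpha> + \<beta>) / 2)) = \<rho> / 2" .
  have im: "(Im e)\<^sup>2 = 1 - (Re e)\<^sup>2" using e by simp
  have "\<epsilon>\<^sup>2 * \<Delta> = of_real (cmod \<Delta>) * e\<^sup>2"
    unfolding e_def by (subst u\<Delta>[symmetric]) (simp add: power_mult_distrib)
  moreover have "Re (e\<^sup>2) = 2 * (Re e)\<^sup>2 - 1"
    using im by (simp add: power2_eq_square)
  ultimately have "Re (\<epsilon>\<^sup>2 * \<Delta>) = cmod \<Delta> * (2 * (Re e)\<^sup>2 - 1)"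
    by simp
  moreover have "Re (\<epsilon>\<^sup>2 * \<Delta>) = Re (\<epsilon>\<^sup>2 * ((\<alpha> - \<beta>) * (\<alpha> - \<beta>))) + 4 * Re (\<epsilon>\<^sup>2 * z)"
    unfolding \<Delta> by (simp add: power2_eq_square algebra_simps)
  moreover have "Re ((\<alpha> - \<beta>) * cnj (\<alpha> - \<beta>)) = (cmod (\<alpha> - \<beta>))\<^sup>2"
    by (simp only: complex_norm_square[symmetric] Re_complex_of_real)
  \<comment> \<open>\<open>Re (\<epsilon>\<^sup>2 * \<Delta>)\<close> is evaluated once through the
    axis direction in e and once through the definition of \<Delta>, which eliminates e from the
    support value.\<close>
  ultimately have D: "cmod \<Delta> * (2 * (Re e)\<^sup>2 - 1)
      = 2 * (Re (\<epsilon> * (\<alpha> - \<beta>)))\<^sup>2 - (cmod (\<alpha> - \<beta>))\<^sup>2 + 4 * Re (\<epsilon>\<^sup>2 * z)"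
    using Re_unit_square[OF \<epsilon>, of "\<alpha> - \<beta>" "\<alpha> - \<beta>"]
    unfolding power2_eq_square[of "Re (\<epsilon> * (\<alpha> - \<beta>))"] by linarith
  have "\<rho>\<^sup>2 = ((cmod (\<alpha> - \<beta>))\<^sup>2 / 2 + h) + cmod \<Delta> * (2 * (Re e)\<^sup>2 - 1) / 2"
    unfolding \<rho>2 x_def y_def using rad rad'
    by (simp add: power_mult_distrib im) (simp add: field_simps)
  then have "\<rho>\<^sup>2 = ?R" unfolding D by argo
  then have "\<rho> = sqrt ?R" by (metis \<rho>_def real_sqrt_abs abs_of_nonneg real_sqrt_ge_zero sum_power2_ge_zero)
  then show ?thesis using mem val by auto
qed

text \<open>Multiplied by \<open>cnj a\<close>, the equation becomes t |p|^2 + \<nu> p + \<delta> =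
  0 with t = |a|^2 and |\<delta>| = |ab - z|. For \<nu> \<noteq> 0 its imaginary part determines Im
  p, and its real part is then a quadratic in Re p whose discriminant q is nonnegative because 2
  |\<delta>| \<le> K.\<close>

lemma isotropic_scalar_exists:
  fixes a b z :: complex and h \<nu> :: real
  assumes a: "a \<noteq> 0" and le: "2 * cmod (a * b - z) + 2 * Re (a * cnj b) \<le> h"
    and \<nu>: "\<nu>\<^sup>2 = (cmod a)\<^sup>2 * h - 2 * Re ((cnj a)\<^sup>2 * z)"
  shows "\<exists>p. a * (p * cnj p) + of_real \<nu> * p / cnj a - z / a + b = 0"
proof -
  define t where "t = (cmod a)\<^sup>2"
  have t: "t > 0" using a by (simp add: t_def)
  have aa: "a * cnj a = of_real t" unfolding t_def by (rule complex_norm_square[symmetric])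
  define \<delta> where "\<delta> = cnj a * (a * b - z) / a"
  define K where "K = h - 2 * Re (a * cnj b)"
  have \<delta>n: "cmod \<delta> = cmod (a * b - z)" using a by (simp add: \<delta>_def norm_mult norm_divide)
  have K: "2 * cmod \<delta> \<le> K" using le by (simp add: \<delta>n K_def)
  have "of_real t * \<delta> = (cnj a)\<^sup>2 * (a * b - z)"
    using a by (simp add: \<delta>_def power2_eq_square flip: aa)
  also have "\<dots> = of_real t * (cnj a * b) - (cnj a)\<^sup>2 * z"
    by (simp add: power2_eq_square algebra_simps flip: aa)
  finally have "Re (of_real t * \<delta>) = Re (of_real t * (cnj a * b) - (cnj a)\<^sup>2 * z)" by simp
  then have "t * Re \<delta> = t * Re (a * cnj b) - Re ((cnj a)\<^sup>2 * z)"
    by (simp add: algebra_simps)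
  then have \<nu>2: "\<nu>\<^sup>2 = t * (K + 2 * Re \<delta>)"
    using \<nu> by (simp add: K_def t_def algebra_simps)
  have "\<exists>p. of_real t * (p * cnj p) + of_real \<nu> * p + \<delta> = 0"
  proof (cases "\<nu> = 0")
    \<comment> \<open>Now \<open>K + 2 * Re \<delta> = 0\<close>, which together with 2 |\<delta>|
      \<le> K forces \<delta> = -|\<delta>|, so a real p suffices.\<close>
    case True
    then have "K + 2 * Re \<delta> = 0" using \<nu>2 t by simp
    then have R: "Re \<delta> = - cmod \<delta>" using K abs_Re_le_cmod[of \<delta>] by linarith
    then have "Im \<delta> = 0" using cmod_power2[of \<delta>] by simp
    then have \<delta>: "\<delta> = - of_real (cmod \<delta>)" using R by (simp add: complex_eq_iff)
    define p where "p = complex_of_real (sqrt (cmod \<delta> / t))"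
    have "p * cnj p = of_real (cmod \<delta> / t)"
      using t unfolding p_def by (simp flip: of_real_mult)
    then have "of_real t * (p * cnj p) + of_real \<nu> * p + \<delta> = of_real t * of_real (cmod \<delta> / t) + \<delta>"
      by (simp add: True)
    also have "\<dots> = 0" using t by (subst (2) \<delta>) simp
    finally show ?thesis by blast
  next
    case False
    define y where "y = - Im \<delta> / \<nu>"
    define q where "q = \<nu>\<^sup>2 - 4 * t * (Re \<delta> + t * y\<^sup>2)"
    define x where "x = (- \<nu> + sqrt q) / (2 * t)"
    have N: "\<nu>\<^sup>2 > 0" using False by simp
    have "\<nu>\<^sup>2 * q = t\<^sup>2 * (K\<^sup>2 - 4 * (cmod \<delta>)\<^sup>2)"
    proof -
      have "\<nu>\<^sup>2 * y\<^sup>2 = (Im \<delta>)\<^sup>2" using False by (simp add: y_def power_divide)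
      moreover have "\<nu>\<^sup>2 * q = \<nu>\<^sup>2 * \<nu>\<^sup>2 - 4 * t * (\<nu>\<^sup>2 * Re \<delta>) - 4 * t\<^sup>2 * (\<nu>\<^sup>2 * y\<^sup>2)"
        by (simp add: q_def algebra_simps power2_eq_square)
      ultimately show ?thesis
        unfolding \<nu>2 cmod_power2 by (simp add: algebra_simps power2_eq_square)
    qed
    moreover have "4 * (cmod \<delta>)\<^sup>2 \<le> K\<^sup>2"
      using power_mono[OF K, of 2] by (simp add: power_mult_distrib)
    ultimately have "0 \<le> \<nu>\<^sup>2 * q" by simp
    then have q: "0 \<le> q" using N by (simp add: zero_le_mult_iff)
    have "2 * t * x + \<nu> = sqrt q" using t by (simp add: x_def)
    then have "(2 * t * x + \<nu>)\<^sup>2 = q" using q by simp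
    then have "4 * t * (t * (x\<^sup>2 + y\<^sup>2) + \<nu> * x + Re \<delta>) = 0"
      by (simp add: q_def algebra_simps power2_eq_square)
    then have 1: "t * (x\<^sup>2 + y\<^sup>2) + \<nu> * x + Re \<delta> = 0" using t by simp
    have 2: "\<nu> * y + Im \<delta> = 0" using False by (simp add: y_def)
    have "of_real t * (Complex x y * cnj (Complex x y)) + of_real \<nu> * Complex x y + \<delta> = 0"
      using 1 2 by (simp add: complex_eq_iff power2_eq_square)
    then show ?thesis by blast
  qed
  then obtain p where p: "of_real t * (p * cnj p) + of_real \<nu> * p + \<delta> = 0" by blast
  have "a * (p * cnj p) + of_real \<nu> * p / cnj a - z / a + b
      = (of_real t * (p * cnj p) + of_real \<nu> * p + \<delta>) / cnj a"
    using a by (simp add: \<delta>_def field_simps flip: aa)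
  then show ?thesis using p by auto
qed

lemma unit_square_rotation: "\<exists>\<epsilon>. cmod \<epsilon> = 1 \<and> \<epsilon>\<^sup>2 * w = of_real (cmod w)"
proof (cases "w = 0")
  case False
  define \<epsilon> where "\<epsilon> = csqrt (cnj (sgn w))"
  have "cmod \<epsilon> = 1" using False by (simp add: \<epsilon>_def norm_sgn)
  moreover have \<epsilon>2: "\<epsilon>\<^sup>2 = cnj (sgn w)" by (simp add: \<epsilon>_def)
  have "\<epsilon>\<^sup>2 * w = of_real (cmod w)"
    using False complex_norm_square[of w] unfolding \<epsilon>2
    by (simp add: sgn_div_norm scaleR_conv_of_real field_simps power2_eq_square)
  ultimately show ?thesis by blast
qed (auto intro: exI[of _ 1])

text \<open>Rotating w = ab - z by \<epsilon>^2 onto the nonnegative real axis lets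
  \<open>Re_unit_square\<close> turn the negated criterion into the product inequality. That
  inequality is unchanged under \<epsilon> -> -\<epsilon>, so the sign can be spent on the condition
  on the sum. If \<open>2 * cmod z \<le> h\<close>, both conditions together make the support
  function of the disc translated by -\<mu> negative in the direction
  \<open>cnj \<epsilon>\<close>.\<close>

lemma outside_disc_direction:
  fixes \<alpha> \<beta> \<mu> z :: complex and h :: real
  assumes "h < 2 * cmod ((\<alpha> - \<mu>) * (\<beta> - \<mu>) - z) + 2 * Re ((\<alpha> - \<mu>) * cnj (\<beta> - \<mu>))"
  shows "\<exists>\<epsilon>. cmod \<epsilon> = 1 \<and> Re (\<epsilon> * (\<alpha> - \<mu>)) + Re (\<epsilon> * (\<beta> - \<mu>)) \<le> 0 \<and>
    h + 2 * Re (\<epsilon>\<^sup>2 * z) < 4 * (Re (\<epsilon> * (\<alpha> - \<mu>)) * Re (\<epsilon> * (\<beta> - \<mu>)))"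
proof -
  define w where "w = (\<alpha> - \<mu>) * (\<beta> - \<mu>) - z"
  obtain \<epsilon>0 where \<epsilon>0: "cmod \<epsilon>0 = 1" "\<epsilon>0\<^sup>2 * w = of_real (cmod w)"
    using unit_square_rotation by blast
  define \<epsilon> where "\<epsilon> = (if Re (\<epsilon>0 * (\<alpha> - \<mu>)) + Re (\<epsilon>0 * (\<beta> - \<mu>)) \<le> 0 then \<epsilon>0 else - \<epsilon>0)"
  have \<epsilon>: "cmod \<epsilon> = 1" and "\<epsilon>\<^sup>2 = \<epsilon>0\<^sup>2" using \<epsilon>0(1) by (simp_all add: \<epsilon>_def)
  have neg: "Re (\<epsilon> * (\<alpha> - \<mu>)) + Re (\<epsilon> * (\<beta> - \<mu>)) \<le> 0" by (simp add: \<epsilon>_def)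
  have "Re (\<epsilon>\<^sup>2 * w) = cmod w" unfolding \<open>\<epsilon>\<^sup>2 = \<epsilon>0\<^sup>2\<close> \<epsilon>0(2) by simp
  then have "Re (\<epsilon>\<^sup>2 * ((\<alpha> - \<mu>) * (\<beta> - \<mu>))) = cmod w + Re (\<epsilon>\<^sup>2 * z)"
    by (simp add: w_def right_diff_distrib)
  then have "4 * (Re (\<epsilon> * (\<alpha> - \<mu>)) * Re (\<epsilon> * (\<beta> - \<mu>)))
      = 2 * cmod w + 2 * Re ((\<alpha> - \<mu>) * cnj (\<beta> - \<mu>)) + 2 * Re (\<epsilon>\<^sup>2 * z)"
    using Re_unit_square[OF \<epsilon>, of "\<alpha> - \<mu>" "\<beta> - \<mu>"] by linarith
  then show ?thesis using assms \<epsilon> neg unfolding w_def[symmetric] by auto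
qed

text \<open>Counterpart of \<open>outside_disc_direction\<close>: the estimate Re (\<epsilon>^2 w)
  \<le> |w| replaces the equality that one special \<epsilon> achieves, so the bound holds in every
  direction.\<close>

lemma Re_product_le_if_mem:
  fixes \<alpha> \<beta> \<mu> z :: complex and h :: real
  assumes "2 * cmod ((\<alpha> - \<mu>) * (\<beta> - \<mu>) - z) + 2 * Re ((\<alpha> - \<mu>) * cnj (\<beta> - \<mu>)) \<le> h"
    and \<epsilon>: "cmod \<epsilon> = 1"
  shows "4 * (Re (\<epsilon> * (\<alpha> - \<mu>)) * Re (\<epsilon> * (\<beta> - \<mu>))) \<le> h + 2 * Re (\<epsilon>\<^sup>2 * z)"
proof -
  define w where "w = (\<alpha> - \<mu>) * (\<beta> - \<mu>) - z"
  have "Re (\<epsilon>\<^sup>2 * w) \<le> cmod w"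
    using complex_Re_le_cmod[of "\<epsilon>\<^sup>2 * w"] \<epsilon> by (simp add: norm_mult norm_power)
  then have "Re (\<epsilon>\<^sup>2 * ((\<alpha> - \<mu>) * (\<beta> - \<mu>))) \<le> cmod w + Re (\<epsilon>\<^sup>2 * z)"
    by (simp add: w_def right_diff_distrib)
  then show ?thesis
    using Re_unit_square[OF \<epsilon>, of "\<alpha> - \<mu>" "\<beta> - \<mu>"] assms(1) unfolding w_def[symmetric] by linarith
qed

subsection \<open>Inner products and orthonormal families\<close>

text \<open>Vectors of length \<open>n\<close> are functions on \<open>nat\<close>, of which only the values below \<open>n\<close> matter.\<close>

definition ip :: "nat \<Rightarrow> (nat \<Rightarrow> complex) \<Rightarrow> (nat \<Rightarrow> complex) \<Rightarrow> complex" where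
  "ip n x y = (\<Sum>i<n. x i * cnj (y i))"

lemma ip_cong:
  "(\<And>l. l < n \<Longrightarrow> x l = x' l) \<Longrightarrow> (\<And>l. l < n \<Longrightarrow> y l = y' l) \<Longrightarrow> ip n x y = ip n x' y'"
  by (simp add: ip_def)

lemma ip_linear_left:
  "ip n (\<lambda>l. x l + x' l) y = ip n x y + ip n x' y"
  "ip n (\<lambda>l. x l - x' l) y = ip n x y - ip n x' y"
  "ip n (\<lambda>l. c * x l) y = c * ip n x y"
  "ip n (\<lambda>l. \<Sum>j\<in>J. f j l) y = (\<Sum>j\<in>J. ip n (f j) y)"
  unfolding ip_def
  by (simp_all add: sum.distrib sum_subtractf sum_distrib_left sum_distrib_right ring_distribs mult.assoc)
    (rule sum.swap)

lemma cnj_ip: "cnj (ip n x y) = ip n y x"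
  by (simp add: ip_def mult.commute)

lemma ip_linear_right:
  "ip n y (\<lambda>l. x l + x' l) = ip n y x + ip n y x'"
  "ip n y (\<lambda>l. x l - x' l) = ip n y x - ip n y x'"
  "ip n y (\<lambda>l. c * x l) = cnj c * ip n y x"
  "ip n y (\<lambda>l. \<Sum>j\<in>J. f j l) = (\<Sum>j\<in>J. ip n y (f j))"
  by (subst cnj_ip[symmetric], simp add: ip_linear_left cnj_ip)+

lemmas ip_linear = ip_linear_left ip_linear_right

lemma ip_self: "ip n x x = of_real (\<Sum>l<n. (cmod (x l))\<^sup>2)"
  by (simp add: ip_def complex_norm_square del: of_real_power)

lemma ip_self_eq_0_iff: "ip n x x = 0 \<longleftrightarrow> (\<forall>l<n. x l = 0)"
  unfolding ip_self of_real_eq_0_iff by (subst sum_nonneg_eq_0_iff) auto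

lemma ip_self_real: "ip n x x = of_real (Re (ip n x x))" and ip_self_nonneg: "0 \<le> Re (ip n x x)"
  unfolding ip_self by (auto intro: sum_nonneg)

lemma sum_lessThan_add: "sum f {..<a + b} = sum f {..<a} + (\<Sum>i<b. f (a + i))"
  for f :: "nat \<Rightarrow> 'a::comm_monoid_add"
  by (induction b) (simp_all add: add.assoc)

lemma ip_add: "ip (a + b) x y = ip a x y + ip b (\<lambda>l. x (a + l)) (\<lambda>l. y (a + l))"
  by (simp add: ip_def sum_lessThan_add)

text \<open>Appending a zero row to the coefficient matrix makes it square with determinant 0, hence
  with a nonzero kernel vector. The dimension counts below go through this lemma.\<close>

lemma nontrivial_solution:
  fixes M :: "nat \<Rightarrow> nat \<Rightarrow> complex"
  shows "\<exists>\<xi>. (\<exists>j<Suc K. \<xi> j \<noteq> 0) \<and> (\<forall>i<K. (\<Sum>j<Suc K. M i j * \<xi> j) = 0)"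
proof -
  define A where "A = mat\<^sub>r (Suc K) (Suc K) (\<lambda>i. if i = K then 0\<^sub>v (Suc K) else vec (Suc K) (M i))"
  have A: "A \<in> carrier_mat (Suc K) (Suc K)" by (simp add: A_def)
  have "det A = 0" unfolding A_def by (rule det_row_0) auto
  then obtain v where v: "v \<in> carrier_vec (Suc K)" "v \<noteq> 0\<^sub>v (Suc K)" "A *\<^sub>v v = 0\<^sub>v (Suc K)"
    using det_0_iff_vec_prod_zero[OF A] by auto
  have "\<exists>j<Suc K. v $ j \<noteq> 0"
    using v(1,2) by (metis carrier_vecD eq_vecI index_zero_vec(1) index_zero_vec(2))
  moreover have "(\<Sum>j<Suc K. M i j * v $ j) = 0" if i: "i < K" for i
  proof -
    have "(A *\<^sub>v v) $ i = 0" using v(3) i by simp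
    then show ?thesis using i v(1) A
      by (simp add: A_def scalar_prod_def atLeast0LessThan del: sum.lessThan_Suc)
  qed
  ultimately show ?thesis by blast
qed

lemma normalise:
  assumes "ip n x x \<noteq> 0"
  shows "\<exists>c. c \<noteq> 0 \<and> ip n (\<lambda>l. c * x l) (\<lambda>l. c * x l) = 1"
proof -
  define s where "s = Re (ip n x x)"
  have s: "ip n x x = of_real s" unfolding s_def by (rule ip_self_real)
  have "s > 0" using assms ip_self_nonneg[of n x] by (auto simp: s_def[symmetric] s less_le)
  then have "1 / sqrt s * (1 / sqrt s * s) = 1" by (simp add: field_simps)
  then have "of_real (1 / sqrt s) \<noteq> (0::complex) \<and>
      ip n (\<lambda>l. of_real (1 / sqrt s) * x l) (\<lambda>l. of_real (1 / sqrt s) * x l) = 1"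
    using \<open>s > 0\<close> unfolding ip_linear s complex_cnj_complex_of_real of_real_mult[symmetric] by simp
  then show ?thesis by blast
qed

text \<open>Gram-Schmidt with a dimension count in place of projections: orthogonality to q earlier
  vectors is q equations on q + 1 coefficients, so a nonzero combination exists, and
  \<open>ind\<close>, the linear independence of the family, allows it to be normalised.\<close>

lemma orthonormal_in_span:
  fixes x :: "nat \<Rightarrow> nat \<Rightarrow> complex" and k n :: nat
  defines "comb \<equiv> \<lambda>\<xi> l. \<Sum>j<k. \<xi> j * x j l"
  assumes ind: "\<And>\<xi>. (\<exists>j<k. \<xi> j \<noteq> 0) \<Longrightarrow> ip n (comb \<xi>) (comb \<xi>) \<noteq> 0"
  shows "q \<le> k \<Longrightarrow> \<exists>\<xi>. \<forall>i<q. \<forall>j<q. ip n (comb (\<xi> i)) (comb (\<xi> j)) = (if i = j then 1 else 0)"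
proof (induction q)
  case (Suc q)
  then obtain \<xi> where \<xi>: "\<And>i j. i < q \<Longrightarrow> j < q \<Longrightarrow>
      ip n (comb (\<xi> i)) (comb (\<xi> j)) = (if i = j then 1 else 0)" by auto
  obtain \<zeta> where \<zeta>: "\<exists>j<Suc q. \<zeta> j \<noteq> 0"
    and \<zeta>0: "\<And>i. i < q \<Longrightarrow> (\<Sum>j<Suc q. ip n (x j) (comb (\<xi> i)) * \<zeta> j) = 0"
    using nontrivial_solution[of q "\<lambda>i j. ip n (x j) (comb (\<xi> i))"] by blast
  define \<eta> where "\<eta> j = (if j < Suc q then \<zeta> j else 0)" for j
  have "\<exists>j<k. \<eta> j \<noteq> 0" using \<zeta> Suc.prems by (fastforce simp: \<eta>_def)
  then obtain c where c: "ip n (\<lambda>l. c * comb \<eta> l) (\<lambda>l. c * comb \<eta> l) = 1"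
    using normalise ind by blast
  have orth: "ip n (comb \<eta>) (comb (\<xi> i)) = 0" if "i < q" for i
  proof -
    have "ip n (comb \<eta>) (comb (\<xi> i)) = (\<Sum>j<k. \<eta> j * ip n (x j) (comb (\<xi> i)))"
      by (subst comb_def) (simp add: ip_linear)
    also have "\<dots> = (\<Sum>j<Suc q. \<eta> j * ip n (x j) (comb (\<xi> i)))"
      using Suc.prems by (intro sum.mono_neutral_right) (auto simp: \<eta>_def)
    also have "\<dots> = (\<Sum>j<Suc q. ip n (x j) (comb (\<xi> i)) * \<zeta> j)"
      by (intro sum.cong) (auto simp: \<eta>_def)
    finally show ?thesis using \<zeta>0[OF that] by simp
  qed
  then have orth': "ip n (comb (\<xi> i)) (comb \<eta>) = 0" if "i < q" for i
    using that by (metis cnj_ip complex_cnj_zero)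
  have comb_c: "comb (\<lambda>j. c * \<eta> j) = (\<lambda>l. c * comb \<eta> l)"
    by (simp add: comb_def sum_distrib_left mult.assoc)
  have "\<forall>i<Suc q. \<forall>j<Suc q. ip n (comb ((\<xi>(q := \<lambda>j. c * \<eta> j)) i)) (comb ((\<xi>(q := \<lambda>j. c * \<eta> j)) j))
      = (if i = j then 1 else 0)"
    using \<xi> c orth orth' by (auto simp: less_Suc_eq comb_c ip_linear mult_ac)
  then show ?case by blast
qed simp

text \<open>A polar decomposition by columns. Nonzero columns are normalised; a zero column leaves
  its f free, so any unit vector orthogonal to the other k - 1 will do, and one exists since k \<le>
  r.\<close>

lemma orthogonal_family_polar:
  fixes w :: "nat \<Rightarrow> nat \<Rightarrow> complex"
  assumes kr: "k \<le> r" and orth: "\<And>i j. i < k \<Longrightarrow> j < k \<Longrightarrow> i \<noteq> j \<Longrightarrow> ip r (w i) (w j) = 0"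
  shows "\<exists>f. (\<forall>i<k. \<forall>j<k. ip r (f i) (f j) = (if i = j then 1 else 0)) \<and>
             (\<forall>j<k. \<forall>l<r. w j l = of_real (sqrt (Re (ip r (w j) (w j)))) * f j l)"
proof -
  define \<nu> where "\<nu> j = sqrt (Re (ip r (w j) (w j)))" for j
  have \<nu>2: "ip r (w j) (w j) = of_real (\<nu> j) * of_real (\<nu> j)" for j
    using ip_self_real[of r "w j"] ip_self_nonneg[of r "w j"]
    by (simp add: \<nu>_def flip: of_real_mult)
  \<comment> \<open>Intermediate families may still contain null vectors, but only at indices where
    \<nu> vanishes.\<close>
  define P where "P f \<longleftrightarrow> (\<forall>i<k. \<forall>j<k. i \<noteq> j \<longrightarrow> ip r (f i) (f j) = 0) \<and>
      (\<forall>j<k. ip r (f j) (f j) = 0 \<and> \<nu> j = 0 \<or> ip r (f j) (f j) = 1) \<and>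
      (\<forall>j<k. \<forall>l<r. w j l = of_real (\<nu> j) * f j l)" for f
  have "\<exists>f. P f \<and> (\<forall>j<q. ip r (f j) (f j) = 1)" if "q \<le> k" for q
    using that
  proof (induction q)
    case 0
    \<comment> \<open>As \<open>inverse 0 = 0\<close>, the initial family is zero exactly at the
      zero columns.\<close>
    have "P (\<lambda>j l. of_real (inverse (\<nu> j)) * w j l)"
      unfolding P_def
    proof (intro conjI allI impI)
      fix j l assume "j < k" "l < r"
      show "w j l = of_real (\<nu> j) * (of_real (inverse (\<nu> j)) * w j l)"
      proof (cases "\<nu> j = 0")
        case True
        then have "ip r (w j) (w j) = 0" by (simp add: \<nu>2)
        then show ?thesis using \<open>l < r\<close> by (simp add: ip_self_eq_0_iff True)
      qed simp
    qed (simp_all add: ip_linear orth \<nu>2, simp add: field_simps)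
    then show ?case by auto
  next
    case (Suc q)
    then obtain f where f: "P f" "\<forall>j<q. ip r (f j) (f j) = 1" by auto
    show ?case
    proof (cases "ip r (f q) (f q) = 1")
      case True
      then show ?thesis using f by (auto simp: less_Suc_eq)
    next
      case False
      moreover have "q < k" using Suc.prems by simp
      ultimately have \<nu>q: "\<nu> q = 0" using f(1) by (auto simp: P_def)
      \<comment> \<open>s enumerates the indices below k other than q by those below k - 1. The
        resulting k - 1 orthogonality conditions are padded by trivial ones to r - 1 equations in r
        unknowns.\<close>
      define s where "s i = (if i = q then k - 1 else i)" for i
      obtain \<xi> where \<xi>: "\<exists>j<Suc (r - 1). \<xi> j \<noteq> 0"
        and \<xi>0: "\<And>i. i < r - 1 \<Longrightarrow> (\<Sum>l<Suc (r - 1). (if i < k - 1 then cnj (f (s i) l) else 0) * \<xi> l) = 0"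
        using nontrivial_solution[of "r - 1" "\<lambda>i l. if i < k - 1 then cnj (f (s i) l) else 0"] by blast
      have r: "Suc (r - 1) = r" using kr Suc.prems by simp
      have "ip r \<xi> \<xi> \<noteq> 0" using \<xi> unfolding r ip_self_eq_0_iff by blast
      then obtain c where c: "ip r (\<lambda>l. c * \<xi> l) (\<lambda>l. c * \<xi> l) = 1" using normalise by blast
      define g where "g = (\<lambda>l. c * \<xi> l)"
      have s0: "ip r \<xi> (f (s i)) = 0" if "i < k - 1" for i
      proof -
        have "i < r - 1" using that kr by simp
        from \<xi>0[OF this] show ?thesis using that unfolding r ip_def by (simp add: mult.commute)
      qed
      have orth: "ip r g (f i) = 0" if "i < k" "i \<noteq> q" for i
      proof -
        have "ip r \<xi> (f i) = 0"
        proof (cases "i = k - 1")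
          case True
          then show ?thesis using s0[of q] that Suc.prems by (auto simp: s_def)
        next
          case False
          then show ?thesis using s0[of i] that by (simp add: s_def)
        qed
        then show ?thesis by (simp add: g_def ip_linear)
      qed
      then have orth': "ip r (f i) g = 0" if "i < k" "i \<noteq> q" for i
        using that by (metis cnj_ip complex_cnj_zero)
      have wq: "w q l = 0" if "l < r" for l
        using f(1) Suc.prems that \<nu>q by (auto simp: P_def)
      have "P (f(q := g))"
        using f(1) orth orth' c wq \<nu>q by (auto simp: P_def g_def)
      moreover have "\<forall>j<Suc q. ip r ((f(q := g)) j) ((f(q := g)) j) = 1"
        using f(2) c by (auto simp: g_def less_Suc_eq)
      ultimately show ?thesis by blast
    qed
  qed
  then obtain f where "P f" "\<forall>j<k. ip r (f j) (f j) = 1" by blast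
  then show ?thesis unfolding P_def \<nu>_def[symmetric] by (intro exI[of _ f]) auto
qed

subsection \<open>Matrices as operators\<close>

lemma adjoint_mult_index:
  assumes "X \<in> carrier_mat n k" "Y \<in> carrier_mat n k'" "i < k" "j < k'"
  shows "(mat_adjoint X * Y) $$ (i, j) = ip n (\<lambda>l. Y $$ (l, j)) (\<lambda>l. X $$ (l, i))"
  using assms
  by (auto simp: mat_adjoint_def ip_def scalar_prod_def atLeast0LessThan mat_of_rows_index intro!: sum.cong)

lemma adjoint_carrier: "X \<in> carrier_mat n k \<Longrightarrow> mat_adjoint X \<in> carrier_mat k n"
  by (auto simp: mat_adjoint_def)

lemma adjoint_index:
  "X \<in> carrier_mat n k \<Longrightarrow> i < k \<Longrightarrow> j < n \<Longrightarrow> mat_adjoint X $$ (i, j) = cnj (X $$ (j, i))"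
  by (auto simp: mat_adjoint_def mat_of_rows_index)

lemma mult_index:
  "X \<in> carrier_mat n k \<Longrightarrow> Y \<in> carrier_mat k k' \<Longrightarrow> i < n \<Longrightarrow> j < k' \<Longrightarrow>
    (X * Y) $$ (i, j) = (\<Sum>l<k. X $$ (i, l) * Y $$ (l, j))"
  by (auto simp: scalar_prod_def atLeast0LessThan)

definition app :: "nat \<Rightarrow> complex mat \<Rightarrow> (nat \<Rightarrow> complex) \<Rightarrow> nat \<Rightarrow> complex" where
  "app n A x l = (\<Sum>l'<n. A $$ (l, l') * x l')"

lemma app_sum: "app n A (\<lambda>l. \<Sum>j\<in>J. c j * f j l) = (\<lambda>l. \<Sum>j\<in>J. c j * app n A (f j) l)"
  unfolding app_def
  by (rule ext, simp add: sum_distrib_left mult.left_commute) (rule sum.swap)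

lemma app_cong: "(\<And>l. l < n \<Longrightarrow> x l = y l) \<Longrightarrow> app n A x = app n A y"
  by (simp add: app_def fun_eq_iff)

lemma ip_app_adjoint:
  assumes D: "D \<in> carrier_mat m r"
  shows "ip m (app r D x) y = ip r x (app m (mat_adjoint D) y)"
proof -
  have "ip m (app r D x) y = (\<Sum>l<m. \<Sum>l'<r. D $$ (l, l') * x l' * cnj (y l))"
    by (simp add: ip_def app_def sum_distrib_right)
  also have "\<dots> = (\<Sum>l'<r. \<Sum>l<m. D $$ (l, l') * x l' * cnj (y l))" by (rule sum.swap)
  also have "\<dots> = ip r x (app m (mat_adjoint D) y)"
    unfolding ip_def app_def
    by (simp add: sum_distrib_left adjoint_index[OF D] mult_ac)
  finally show ?thesis .
qed

lemma adjoint_adjoint: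
  fixes X :: "complex mat"
  assumes "X \<in> carrier_mat n k" shows "mat_adjoint (mat_adjoint X) = X"
  using assms adjoint_carrier[OF assms] adjoint_carrier[OF adjoint_carrier[OF assms]]
  by (intro eq_matI) (auto simp: adjoint_index[OF assms] adjoint_index[OF adjoint_carrier[OF assms]])

lemma app_mult:
  assumes "X \<in> carrier_mat n k" "Y \<in> carrier_mat k k'" "l < n"
  shows "app k' (X * Y) x l = app k X (app k' Y x) l"
  unfolding app_def using assms
  by (simp add: mult_index[OF assms(1,2)] sum_distrib_left sum_distrib_right mult.assoc del: index_mult_mat)
    (rule sum.swap)

lemma app_add:
  assumes "X \<in> carrier_mat n k" "Y \<in> carrier_mat n k" "l < n"
  shows "app k (X + Y) x l = app k X x l + app k Y x l"
  unfolding app_def using assms by (simp add: sum.distrib ring_distribs)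

text \<open>The family x consists of the columns of X, and both matrix equations are read entrywise;
  this is the form in which both inclusions use membership.\<close>

lemma mem_rank_numerical_range_iff:
  assumes A: "A \<in> carrier_mat n n"
  shows "\<mu> \<in> rank_numerical_range k A \<longleftrightarrow>
    (\<exists>x. \<forall>i<k. \<forall>j<k. ip n (x j) (x i) = (if i = j then 1 else 0) \<and>
                     ip n (app n A (x j)) (x i) = (if i = j then \<mu> else 0))"
proof -
  have *: "mat_adjoint X * X = 1\<^sub>m k \<and> mat_adjoint X * A * X = \<mu> \<cdot>\<^sub>m 1\<^sub>m k \<longleftrightarrow>
     (\<forall>i<k. \<forall>j<k. ip n (\<lambda>l. X $$ (l, j)) (\<lambda>l. X $$ (l, i)) = (if i = j then 1 else 0) \<and>
          ip n (app n A (\<lambda>l. X $$ (l, j))) (\<lambda>l. X $$ (l, i)) = (if i = j then \<mu> else 0))"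
    if X: "X \<in> carrier_mat n k" for X
  proof -
    have AX: "A * X \<in> carrier_mat n k" using A X by simp
    have assoc: "mat_adjoint X * A * X = mat_adjoint X * (A * X)"
      using adjoint_carrier[OF X] A X by (rule assoc_mult_mat)
    have 1: "mat_adjoint X * X = 1\<^sub>m k \<longleftrightarrow>
      (\<forall>i<k. \<forall>j<k. (mat_adjoint X * X) $$ (i, j) = (if i = j then 1 else 0))"
      using adjoint_carrier[OF X] X by (auto simp: mat_eq_iff)
    have 2: "mat_adjoint X * (A * X) = \<mu> \<cdot>\<^sub>m 1\<^sub>m k \<longleftrightarrow>
      (\<forall>i<k. \<forall>j<k. (mat_adjoint X * (A * X)) $$ (i, j) = (if i = j then \<mu> else 0))"
      using adjoint_carrier[OF X] A X by (auto simp: mat_eq_iff)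
    have 3: "ip n (\<lambda>l. (A * X) $$ (l, j)) (\<lambda>l. X $$ (l, i)) = ip n (app n A (\<lambda>l. X $$ (l, j))) (\<lambda>l. X $$ (l, i))"
      if "j < k" for i j
      using mult_index[OF A X _ that] by (intro ip_cong) (simp_all add: app_def)
    show ?thesis
      unfolding assoc 1 2
      by (auto simp: adjoint_mult_index[OF X X] adjoint_mult_index[OF X AX] 3)
  qed
  show ?thesis
  proof
    assume "\<mu> \<in> rank_numerical_range k A"
    then obtain X where "X \<in> carrier_mat n k" "mat_adjoint X * X = 1\<^sub>m k \<and> mat_adjoint X * A * X = \<mu> \<cdot>\<^sub>m 1\<^sub>m k"
      using A by (auto simp: rank_numerical_range_def)
    then show "\<exists>x. \<forall>i<k. \<forall>j<k. ip n (x j) (x i) = (if i = j then 1 else 0) \<and>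
                     ip n (app n A (x j)) (x i) = (if i = j then \<mu> else 0)"
      using * by (intro exI[of _ "\<lambda>j l. X $$ (l, j)"]) auto
  next
    assume "\<exists>x. \<forall>i<k. \<forall>j<k. ip n (x j) (x i) = (if i = j then 1 else 0) \<and>
                     ip n (app n A (x j)) (x i) = (if i = j then \<mu> else 0)"
    then obtain x where x: "\<forall>i<k. \<forall>j<k. ip n (x j) (x i) = (if i = j then 1 else 0) \<and>
                     ip n (app n A (x j)) (x i) = (if i = j then \<mu> else 0)" by blast
    define X where "X = Matrix.mat n k (\<lambda>(l, j). x j l)"
    have X: "X \<in> carrier_mat n k" by (simp add: X_def)
    have "ip n (\<lambda>l. X $$ (l, j)) (\<lambda>l. X $$ (l, i)) = ip n (x j) (x i)"
      "ip n (app n A (\<lambda>l. X $$ (l, j))) (\<lambda>l. X $$ (l, i)) = ip n (app n A (x j)) (x i)"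
      if "i < k" "j < k" for i j
      using that by (auto simp: X_def intro!: ip_cong fun_cong[OF app_cong])
    then have "mat_adjoint X * X = 1\<^sub>m k \<and> mat_adjoint X * A * X = \<mu> \<cdot>\<^sub>m 1\<^sub>m k"
      using x unfolding *[OF X] by simp
    then show "\<mu> \<in> rank_numerical_range k A"
      using X A by (auto simp: rank_numerical_range_def)
  qed
qed

text \<open>The identity between the two sesquilinear forms passes from x to all linear
  combinations, hence to an orthonormal basis of the span, which \<open>orthonormal_in_span\<close>
  supplies.\<close>

lemma mem_rank_numerical_range_span:
  fixes x :: "nat \<Rightarrow> nat \<Rightarrow> complex"
  assumes A: "A \<in> carrier_mat n n"
    and form: "\<And>i j. i < k \<Longrightarrow> j < k \<Longrightarrow> ip n (app n A (x j)) (x i) = \<mu> * ip n (x j) (x i)"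
    and ind: "\<And>\<xi>. (\<exists>j<k. \<xi> j \<noteq> 0) \<Longrightarrow>
      ip n (\<lambda>l. \<Sum>j<k. \<xi> j * x j l) (\<lambda>l. \<Sum>j<k. \<xi> j * x j l) \<noteq> 0"
  shows "\<mu> \<in> rank_numerical_range k A"
proof -
  obtain \<xi> where \<xi>: "\<forall>i<k. \<forall>j<k. ip n (\<lambda>l. \<Sum>j'<k. \<xi> i j' * x j' l) (\<lambda>l. \<Sum>j'<k. \<xi> j j' * x j' l)
      = (if i = j then 1 else 0)"
    using orthonormal_in_span[where x = x and n = n and k = k and q = k] ind by auto
  have "ip n (app n A (\<lambda>l. \<Sum>j<k. \<eta> j * x j l)) (\<lambda>l. \<Sum>j<k. \<zeta> j * x j l)
      = \<mu> * ip n (\<lambda>l. \<Sum>j<k. \<eta> j * x j l) (\<lambda>l. \<Sum>j<k. \<zeta> j * x j l)" for \<eta> \<zeta>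
    by (simp add: app_sum ip_linear sum_distrib_left form algebra_simps)
  then show ?thesis
    unfolding mem_rank_numerical_range_iff[OF A]
    using \<xi> by (intro exI[of _ "\<lambda>i l. \<Sum>j'<k. \<xi> i j' * x j' l"]) auto
qed

subsection \<open>Blocks with diagonal Gram data\<close>

text \<open>\<open>v\<close> lists the columns of \<open>U\<close>, and \<open>c\<close>, \<open>d\<close> those of \<open>CU\<close> and \<open>D\<^sup>*U\<close>;
  indices start at \<open>0\<close> here, but at \<open>1\<close> in the theorem.\<close>

locale diagonalised_block =
  fixes r m :: nat and A C D :: "complex mat" and \<alpha> \<beta> :: complex
    and v :: "nat \<Rightarrow> nat \<Rightarrow> complex" and z :: "nat \<Rightarrow> complex" and h :: "nat \<Rightarrow> real"
    and c d :: "nat \<Rightarrow> nat \<Rightarrow> complex"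
  assumes C: "C \<in> carrier_mat r m" and D: "D \<in> carrier_mat m r"
    and A_def: "A = four_block_mat (\<alpha> \<cdot>\<^sub>m 1\<^sub>m r) C D (\<beta> \<cdot>\<^sub>m 1\<^sub>m m)"
    and c_def: "c = (\<lambda>j. app m C (v j))" and d_def: "d = (\<lambda>j. app m (mat_adjoint D) (v j))"
    and v_orthonormal: "\<And>i j. i < m \<Longrightarrow> j < m \<Longrightarrow> ip m (v i) (v j) = (if i = j then 1 else 0)"
    and v_complete: "\<And>y l. l < m \<Longrightarrow> y l = (\<Sum>j<m. ip m y (v j) * v j l)"
    and cd: "\<And>i j. i < m \<Longrightarrow> j < m \<Longrightarrow> ip r (c j) (d i) = (if i = j then z i else 0)"
    and cc_dd: "\<And>i j. i < m \<Longrightarrow> j < m \<Longrightarrow>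
      ip r (c j) (c i) + ip r (d j) (d i) = (if i = j then of_real (h i) else 0)"
begin

lemma A: "A \<in> carrier_mat (r + m) (r + m)"
  using C D by (simp add: A_def)

lemma dc: "i < m \<Longrightarrow> j < m \<Longrightarrow> ip r (d j) (c i) = (if i = j then cnj (z i) else 0)"
  using cd[of j i] by (auto simp flip: cnj_ip[of r "c i"])

text \<open>Moving D to the other argument as its adjoint makes C and \<open>mat_adjoint D\<close>
  act on lower halves only; expanding these in v then brings in just c and d.\<close>

lemma ip_app_A:
  "ip (r + m) (app (r + m) A x) y =
     \<alpha> * ip r x y + ip r (app m C (\<lambda>l. x (r + l))) y
     + ip r x (app m (mat_adjoint D) (\<lambda>l. y (r + l))) + \<beta> * ip m (\<lambda>l. x (r + l)) (\<lambda>l. y (r + l))"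
proof -
  have "app (r + m) A x l = \<alpha> * x l + app m C (\<lambda>l. x (r + l)) l" if "l < r" for l
    using that C D
    by (simp add: app_def sum_lessThan_add A_def if_distrib[of "\<lambda>t. t * _"] if_distrib[of "\<lambda>t. \<alpha> * t"] sum.delta' cong: if_cong)
  moreover have "app (r + m) A x (r + l) = app r D x l + \<beta> * x (r + l)" if "l < m" for l
    using that C D
    by (simp add: app_def sum_lessThan_add A_def if_distrib[of "\<lambda>t. t * _"] if_distrib[of "\<lambda>t. \<beta> * t"] sum.delta' cong: if_cong)
  ultimately have "ip (r + m) (app (r + m) A x) y =
      ip r (\<lambda>l. \<alpha> * x l + app m C (\<lambda>l. x (r + l)) l) y
      + ip m (\<lambda>l. app r D x l + \<beta> * x (r + l)) (\<lambda>l. y (r + l))"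
    unfolding ip_add by (intro arg_cong2[of _ _ _ _ "(+)"] ip_cong) auto
  then show ?thesis by (simp add: ip_linear ip_app_adjoint[OF D])
qed

text \<open>The block \<epsilon> C + cnj \<epsilon> D^* is the upper right block of twice the
  Hermitian part of \<epsilon> A. Its Gram matrix is H plus \<epsilon>^2 Z plus the adjoint of
  \<epsilon>^2 Z, which is diagonal in the basis v.\<close>

lemma gram_rotated:
  assumes \<epsilon>: "cmod \<epsilon> = 1" and ij: "i < m" "j < m"
  shows "ip r (\<lambda>l. \<epsilon> * c j l + cnj \<epsilon> * d j l) (\<lambda>l. \<epsilon> * c i l + cnj \<epsilon> * d i l)
    = (if i = j then of_real (h i + 2 * Re (\<epsilon>\<^sup>2 * z i)) else 0)"
proof -
  have ee: "\<epsilon> * cnj \<epsilon> = 1" using complex_norm_square[of \<epsilon>] \<epsilon> by simp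
  have "ip r (\<lambda>l. \<epsilon> * c j l + cnj \<epsilon> * d j l) (\<lambda>l. \<epsilon> * c i l + cnj \<epsilon> * d i l)
    = (\<epsilon> * cnj \<epsilon>) * (ip r (c j) (c i) + ip r (d j) (d i))
      + (\<epsilon>\<^sup>2 * ip r (c j) (d i) + (cnj \<epsilon>)\<^sup>2 * ip r (d j) (c i))"
    by (simp add: ip_linear power2_eq_square algebra_simps)
  also have "\<dots> = (if i = j then of_real (h i) + (\<epsilon>\<^sup>2 * z i + cnj (\<epsilon>\<^sup>2 * z i)) else 0)"
    unfolding ee cc_dd[OF ij] cd[OF ij] dc[OF ij] by simp
  also have "\<dots> = (if i = j then of_real (h i + 2 * Re (\<epsilon>\<^sup>2 * z i)) else 0)"
    by (simp only: complex_add_cnj of_real_add)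
  finally show ?thesis .
qed

lemma rotated_nonneg:
  assumes "cmod \<epsilon> = 1" "j < m" shows "0 \<le> h j + 2 * Re (\<epsilon>\<^sup>2 * z j)"
  using ip_self_nonneg[of r "\<lambda>l. \<epsilon> * c j l + cnj \<epsilon> * d j l"]
  by (subst (asm) gram_rotated[OF assms(1,2,2)]) simp

text \<open>For \<epsilon>^2 z_j = -|z_j| the squared length behind \<open>rotated_nonneg\<close>
  equals h_j - 2 |z_j|. The bound guarantees that the axis lengths of the discs are real.\<close>

lemma z_le_h: assumes "j < m" shows "2 * cmod (z j) \<le> h j"
proof -
  obtain \<epsilon> where "cmod \<epsilon> = 1" and \<epsilon>: "\<epsilon>\<^sup>2 * - z j = of_real (cmod (- z j))"
    using unit_square_rotation by blast
  moreover have "Re (\<epsilon>\<^sup>2 * z j) = - cmod (z j)"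
    using arg_cong[OF \<epsilon>, of Re] by simp
  ultimately show ?thesis using rotated_nonneg[of \<epsilon> j] assms by simp
qed

lemma mem_rank_numerical_range_if:
  assumes km: "k \<le> m" and kr: "k \<le> r"
    and le: "\<And>j. j < k \<Longrightarrow>
      2 * cmod ((\<alpha> - \<mu>) * (\<beta> - \<mu>) - z j) + 2 * Re ((\<alpha> - \<mu>) * cnj (\<beta> - \<mu>)) \<le> h j"
  shows "\<mu> \<in> rank_numerical_range k A"
proof (cases "\<alpha> = \<mu>")
  case True
  \<comment> \<open>Since k \<le> r, these basis vectors live in the top block, where the form of A
    is \<alpha> = \<mu> times the inner product.\<close>
  define x where "x j l = (if l = j then 1 else 0 :: complex)" for j l :: nat
  have on: "ip r (x j) (x i) = (if i = j then 1 else 0)" if "i < k" "j < k" for i j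
    using that kr by (auto simp: ip_def x_def if_distrib[of cnj] if_distrib[of "\<lambda>t. t * _"] cong: if_cong)
  have bot: "x j (r + l) = 0" if "j < k" for j l
    using that kr by (simp add: x_def)
  have 0: "app m B (\<lambda>l. 0) = (\<lambda>l. 0)" "ip n y (\<lambda>l. 0) = 0" "ip n (\<lambda>l. 0) y = 0" for B n y
    by (auto simp: app_def ip_def)
  have "ip (r + m) (x j) (x i) = (if i = j then 1 else 0)" if "i < k" "j < k" for i j
    using that by (simp add: ip_add on bot 0)
  moreover have "ip (r + m) (app (r + m) A (x j)) (x i) = (if i = j then \<mu> else 0)"
    if "i < k" "j < k" for i j
    using that by (simp add: ip_app_A on bot 0 True)
  ultimately show ?thesis
    unfolding mem_rank_numerical_range_iff[OF A] by (intro exI[of _ x]) auto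
next
  case False
  define a b where "a = \<alpha> - \<mu>" and "b = \<beta> - \<mu>"
  have a: "a \<noteq> 0" using False by (simp add: a_def)
  \<comment> \<open>Chosen so that the cross terms of f with c and d in \<open>form\<close> combine
    into the inner product of f with w, divided by \<open>cnj a\<close>.\<close>
  define w where "w j = (\<lambda>l. a * d j l - cnj a * c j l)" for j
  have ww: "ip r (w i) (w j) = (if i = j then of_real ((cmod a)\<^sup>2 * h j - 2 * Re ((cnj a)\<^sup>2 * z j)) else 0)"
    if "i < m" "j < m" for i j
  proof -
    have "ip r (w i) (w j) = a * cnj a * (ip r (c i) (c j) + ip r (d i) (d j))
        - ((cnj a)\<^sup>2 * ip r (c i) (d j) + a\<^sup>2 * ip r (d i) (c j))"
      by (simp add: w_def ip_linear power2_eq_square algebra_simps)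
    also have "\<dots> = (if i = j then a * cnj a * of_real (h j) - ((cnj a)\<^sup>2 * z j + cnj ((cnj a)\<^sup>2 * z j)) else 0)"
      using that by (auto simp: cc_dd cd dc)
    also have "\<dots> = (if i = j then of_real ((cmod a)\<^sup>2 * h j - 2 * Re ((cnj a)\<^sup>2 * z j)) else 0)"
      unfolding complex_add_cnj by (simp flip: complex_norm_square)
    finally show ?thesis .
  qed
  obtain f where f: "\<And>i j. i < k \<Longrightarrow> j < k \<Longrightarrow> ip r (f i) (f j) = (if i = j then 1 else 0)"
    and wf: "\<And>j l. j < k \<Longrightarrow> l < r \<Longrightarrow> w j l = of_real (sqrt (Re (ip r (w j) (w j)))) * f j l"
    using orthogonal_family_polar[OF kr, of w] ww km by force
  define \<nu> where "\<nu> j = sqrt (Re (ip r (w j) (w j)))" for j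
  have "\<exists>p. a * (p * cnj p) + of_real (\<nu> j) * p / cnj a - z j / a + b = 0" if "j < k" for j
  proof (rule isotropic_scalar_exists[OF a])
    show "2 * cmod (a * b - z j) + 2 * Re (a * cnj b) \<le> h j"
      using le[OF that] by (simp add: a_def b_def)
    have "(\<nu> j)\<^sup>2 = Re (ip r (w j) (w j))" using ip_self_nonneg by (simp add: \<nu>_def)
    then show "(\<nu> j)\<^sup>2 = (cmod a)\<^sup>2 * h j - 2 * Re ((cnj a)\<^sup>2 * z j)"
      using that km by (simp add: ww)
  qed
  then obtain p where p: "\<And>j. j < k \<Longrightarrow>
      a * (p j * cnj (p j)) + of_real (\<nu> j) * p j / cnj a - z j / a + b = 0" by metis
  \<comment> \<open>The summand with c absorbs the contribution of C, since a t_j + c_j = a p_j f_j.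
    What remains is diagonal, and p_j was chosen to make the diagonal entry vanish.\<close>
  define t where "t j = (\<lambda>l. p j * f j l - inverse a * c j l)" for j
  define x where "x j l = (if l < r then t j l else v j (l - r))" for j l
  have top: "ip r (x j) y = ip r (t j) y" "ip r y (x j) = ip r y (t j)" for j y
    by (auto intro!: ip_cong simp: x_def)
  have bot: "x j (r + l) = v j l" for j l by (simp add: x_def)
  have form: "a * ip r (t j) (t i) + ip r (c j) (t i) + ip r (t j) (d i) + b * ip m (v j) (v i) = 0"
    if i: "i < k" and j: "j < k" for i j
  proof -
    have ij: "i < m" "j < m" using i j km by auto
    have "(\<lambda>l. a * t j l + c j l) = (\<lambda>l. a * p j * f j l)"
      using a by (simp add: t_def fun_eq_iff field_simps)
    then have "a * ip r (t j) (t i) + ip r (c j) (t i) = a * p j * ip r (f j) (t i)"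
      by (simp flip: ip_linear_left)
    also have "\<dots> = a * p j * cnj (p i) * ip r (f j) (f i) - p j * a / cnj a * ip r (f j) (c i)"
      by (simp add: t_def ip_linear divide_inverse algebra_simps)
    finally have 1: "a * ip r (t j) (t i) + ip r (c j) (t i) = \<dots>" .
    have 2: "ip r (t j) (d i) = p j * ip r (f j) (d i) - (if i = j then z j / a else 0)"
      using cd[OF ij] by (simp add: t_def ip_linear divide_inverse)
    have "ip r (f j) (w i) = of_real (\<nu> i) * ip r (f j) (f i)"
    proof -
      have "ip r (f j) (w i) = ip r (f j) (\<lambda>l. of_real (\<nu> i) * f i l)"
        using wf[OF i] by (intro ip_cong) (auto simp: \<nu>_def)
      then show ?thesis by (simp add: ip_linear)
    qed
    moreover have "ip r (f j) (w i) = cnj a * ip r (f j) (d i) - a * ip r (f j) (c i)"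
      by (simp add: w_def ip_linear)
    ultimately have "cnj a * ip r (f j) (d i) = of_real (\<nu> i) * ip r (f j) (f i) + a * ip r (f j) (c i)"
      by (metis diff_add_cancel)
    then have 3: "ip r (f j) (d i) = (of_real (\<nu> i) * ip r (f j) (f i) + a * ip r (f j) (c i)) / cnj a"
      using a by (simp add: field_simps)
    have "a * ip r (t j) (t i) + ip r (c j) (t i) + ip r (t j) (d i) + b * ip m (v j) (v i)
      = (if i = j then a * (p j * cnj (p j)) + of_real (\<nu> j) * p j / cnj a - z j / a + b else 0)"
      unfolding 1 2 3 using f[OF j i] v_orthonormal[OF ij(2,1)]
      by (auto simp: add_divide_distrib algebra_simps)
    then show ?thesis using p[OF j] by simp
  qed
  show ?thesis
  proof (rule mem_rank_numerical_range_span[OF A, where x = x])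
    fix i j assume "i < k" "j < k"
    from form[OF this] show "ip (r + m) (app (r + m) A (x j)) (x i) = \<mu> * ip (r + m) (x j) (x i)"
      unfolding ip_app_A ip_add[of r m "x j"] top bot a_def b_def c_def d_def
      by (simp add: algebra_simps)
  next
    fix \<xi> :: "nat \<Rightarrow> complex" assume nz: "\<exists>j<k. \<xi> j \<noteq> 0"
    show "ip (r + m) (\<lambda>l. \<Sum>j<k. \<xi> j * x j l) (\<lambda>l. \<Sum>j<k. \<xi> j * x j l) \<noteq> 0"
    proof
      assume 0: "ip (r + m) (\<lambda>l. \<Sum>j<k. \<xi> j * x j l) (\<lambda>l. \<Sum>j<k. \<xi> j * x j l) = 0"
      \<comment> \<open>The lower halves are the orthonormal v_j, so they alone force all
        coefficients to vanish.\<close>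
      have "(\<Sum>j<k. \<xi> j * v j l) = 0" if "l < m" for l
        using 0[unfolded ip_self_eq_0_iff, rule_format, of "r + l"] that by (simp add: bot)
      then have "ip m (\<lambda>l. \<Sum>j<k. \<xi> j * v j l) (v i) = 0" for i
        by (simp add: ip_def)
      moreover have "ip m (\<lambda>l. \<Sum>j<k. \<xi> j * v j l) (v i) = \<xi> i" if "i < k" for i
        using that km by (simp add: ip_linear v_orthonormal if_distrib[of "\<lambda>t. _ * t"] cong: if_cong)
      ultimately show False using nz by metis
    qed
  qed
qed

text \<open>Take X in the span of x with lower half Y orthogonal to the first k - 1 vectors v, and
  let X' be its upper half. The real part of \<epsilon> times the form of A - \<mu> at X gives a
  |X'|^2 + Re <G, X'> + b |Y|^2 = 0. Completing the square, |2a X' + G|^2 is the sum of (\<Gamma>_j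
  - 4ab) |\<eta>_j|^2, which \<open>lt\<close> makes nonpositive; so Y = 0 and then X' = 0. Indices
  start at 0, so \<open>k - 1 \<le> j\<close> is the range j \<ge> k of the theorem.\<close>

lemma not_mem_rank_numerical_range:
  assumes k: "1 \<le> k" "k \<le> m" and \<epsilon>: "cmod \<epsilon> = 1"
    and neg: "Re (\<epsilon> * (\<alpha> - \<mu>)) + Re (\<epsilon> * (\<beta> - \<mu>)) \<le> 0"
    and lt: "\<And>j. k - 1 \<le> j \<Longrightarrow> j < m \<Longrightarrow>
      h j + 2 * Re (\<epsilon>\<^sup>2 * z j) < 4 * (Re (\<epsilon> * (\<alpha> - \<mu>)) * Re (\<epsilon> * (\<beta> - \<mu>)))"
  shows "\<mu> \<notin> rank_numerical_range k A"
proof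
  assume "\<mu> \<in> rank_numerical_range k A"
  then obtain x where x1: "\<And>i j. i < k \<Longrightarrow> j < k \<Longrightarrow> ip (r + m) (x j) (x i) = (if i = j then 1 else 0)"
    and x2: "\<And>i j. i < k \<Longrightarrow> j < k \<Longrightarrow>
      ip (r + m) (app (r + m) A (x j)) (x i) = (if i = j then \<mu> else 0)"
    unfolding mem_rank_numerical_range_iff[OF A] by metis
  define a b where "a = Re (\<epsilon> * (\<alpha> - \<mu>))" and "b = Re (\<epsilon> * (\<beta> - \<mu>))"
  define \<Gamma> where "\<Gamma> j = h j + 2 * Re (\<epsilon>\<^sup>2 * z j)" for j
  have \<Gamma>lt: "\<Gamma> j < 4 * (a * b)" if "k - 1 \<le> j" "j < m" for j
    using lt[OF that] by (simp add: \<Gamma>_def a_def b_def)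
  \<comment> \<open>The index k - 1 is below m and yields 0 \<le> \<Gamma> < 4ab; as a + b \<le> 0,
    both a and b are negative.\<close>
  have "0 \<le> \<Gamma> (k - 1)" using rotated_nonneg[OF \<epsilon>] k by (simp add: \<Gamma>_def)
  moreover have "k - 1 < m" using k by simp
  ultimately have "0 < a * b" using \<Gamma>lt[of "k - 1"] by simp
  then have a_neg: "a < 0" using neg by (auto simp: zero_less_mult_iff a_def b_def)
  \<comment> \<open>These are k - 1 orthogonality conditions on the k coefficients of a vector in
    the span of x.\<close>
  obtain \<xi> where \<xi>: "\<exists>j<k. \<xi> j \<noteq> 0"
    and \<xi>0: "\<And>i. i < k - 1 \<Longrightarrow> (\<Sum>j<k. ip m (\<lambda>l. x j (r + l)) (v i) * \<xi> j) = 0"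
    using nontrivial_solution[of "k - 1" "\<lambda>i j. ip m (\<lambda>l. x j (r + l)) (v i)"] k by auto
  define X where "X = (\<lambda>l. \<Sum>j<k. \<xi> j * x j l)"
  define Y where "Y = (\<lambda>l. X (r + l))"
  define \<eta> where "\<eta> j = ip m Y (v j)" for j
  have form: "ip (r + m) (app (r + m) A X) X = \<mu> * ip (r + m) X X"
    unfolding X_def
    by (simp add: app_sum ip_linear x1 x2 sum_distrib_left if_distrib[of "\<lambda>t. _ * t"] mult_ac cong: if_cong)
  have Xnz: "ip (r + m) X X \<noteq> 0"
  proof
    assume "ip (r + m) X X = 0"
    then have "ip (r + m) X (x i) = 0" for i by (simp add: ip_self_eq_0_iff) (simp add: ip_def)
    moreover have "ip (r + m) X (x i) = \<xi> i" if "i < k" for i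
      using that by (simp add: X_def ip_linear x1 if_distrib[of "\<lambda>t. _ * t"] cong: if_cong)
    ultimately show False using \<xi> by metis
  qed
  have \<eta>0: "\<eta> i = 0" if "i < k - 1" for i
    using \<xi>0[OF that] by (simp add: \<eta>_def Y_def X_def ip_linear mult.commute)
  have Y: "Y l = (\<Sum>j<m. \<eta> j * v j l)" if "l < m" for l
    unfolding \<eta>_def using v_complete[OF that, of Y] .
  have CY: "app m C Y = (\<lambda>l. \<Sum>j<m. \<eta> j * c j l)"
    unfolding c_def by (subst app_cong[OF Y]) (simp_all add: app_sum)
  have DY: "app m (mat_adjoint D) Y = (\<lambda>l. \<Sum>j<m. \<eta> j * d j l)"
    unfolding d_def by (subst app_cong[OF Y]) (simp_all add: app_sum)
  have YY: "ip m Y Y = of_real (\<Sum>j<m. (cmod (\<eta> j))\<^sup>2)"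
  proof -
    have "ip m Y Y = ip m Y (\<lambda>l. \<Sum>j<m. \<eta> j * v j l)" using Y by (intro ip_cong) auto
    also have "\<dots> = (\<Sum>j<m. cnj (\<eta> j) * \<eta> j)" by (simp add: ip_linear \<eta>_def)
    finally show ?thesis by (simp add: complex_norm_square mult.commute del: of_real_power)
  qed
  define N where "N = Re (ip r X X)"
  have XX: "ip r X X = of_real N" unfolding N_def by (rule ip_self_real)
  \<comment> \<open>On the upper block G is the image of Y under \<epsilon> C + cnj \<epsilon> D^*,
    so by \<open>gram_rotated\<close> its squared length is diagonal in \<eta>.\<close>
  define G where "G = (\<lambda>l. \<Sum>j<m. \<eta> j * (\<epsilon> * c j l + cnj \<epsilon> * d j l))"
  have G: "ip r G X = \<epsilon> * ip r (app m C Y) X + cnj \<epsilon> * ip r (app m (mat_adjoint D) Y) X"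
    unfolding CY DY G_def by (simp add: ip_linear sum.distrib sum_distrib_left algebra_simps)
  have "Re (cnj \<epsilon> * ip r (app m (mat_adjoint D) Y) X) = Re (\<epsilon> * ip r X (app m (mat_adjoint D) Y))"
    by (subst (2) cnj_ip[symmetric]) simp
  then have ReG: "Re (ip r G X) = Re (\<epsilon> * (ip r (app m C Y) X + ip r X (app m (mat_adjoint D) Y)))"
    unfolding G by (simp add: algebra_simps)
  have "(\<alpha> - \<mu>) * ip r X X + (ip r (app m C Y) X + ip r X (app m (mat_adjoint D) Y))
      + (\<beta> - \<mu>) * ip m Y Y = 0"
    using form unfolding ip_app_A ip_add[of r m X] Y_def[symmetric] by (simp add: algebra_simps)
  then have "Re (\<epsilon> * ((\<alpha> - \<mu>) * ip r X X + (ip r (app m C Y) X + ip r X (app m (mat_adjoint D) Y))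
      + (\<beta> - \<mu>) * ip m Y Y)) = 0" by simp
  then have eq: "a * N + Re (ip r G X) + b * (\<Sum>j<m. (cmod (\<eta> j))\<^sup>2) = 0"
    unfolding ReG XX YY a_def b_def by (simp add: algebra_simps)
  have GG: "ip r G G = of_real (\<Sum>j<m. \<Gamma> j * (cmod (\<eta> j))\<^sup>2)"
  proof -
    have "ip r G G = (\<Sum>j<m. \<Sum>i<m. \<eta> j * (cnj (\<eta> i) *
        ip r (\<lambda>l. \<epsilon> * c j l + cnj \<epsilon> * d j l) (\<lambda>l. \<epsilon> * c i l + cnj \<epsilon> * d i l)))"
      unfolding G_def by (simp only: ip_linear_left(3,4) ip_linear_right(3,4) sum_distrib_left)
    also have "\<dots> = (\<Sum>j<m. \<eta> j * (cnj (\<eta> j) * of_real (\<Gamma> j)))"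
    proof (rule sum.cong[OF refl])
      fix j assume j: "j \<in> {..<m}"
      have "(\<Sum>i<m. \<eta> j * (cnj (\<eta> i) *
          ip r (\<lambda>l. \<epsilon> * c j l + cnj \<epsilon> * d j l) (\<lambda>l. \<epsilon> * c i l + cnj \<epsilon> * d i l)))
        = (\<Sum>i<m. if i = j then \<eta> j * (cnj (\<eta> j) * of_real (\<Gamma> j)) else 0)"
        using j by (intro sum.cong) (auto simp: gram_rotated[OF \<epsilon>] \<Gamma>_def)
      then show "(\<Sum>i<m. \<eta> j * (cnj (\<eta> i) *
          ip r (\<lambda>l. \<epsilon> * c j l + cnj \<epsilon> * d j l) (\<lambda>l. \<epsilon> * c i l + cnj \<epsilon> * d i l)))
        = \<eta> j * (cnj (\<eta> j) * of_real (\<Gamma> j))" using j by simp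
    qed
    also have "\<dots> = of_real (\<Sum>j<m. \<Gamma> j * (cmod (\<eta> j))\<^sup>2)"
      by (simp add: complex_norm_square mult_ac del: of_real_power)
    finally show ?thesis .
  qed
  \<comment> \<open>With t = 2a the squared length of t X + G contains 4a (a N + Re <G, X>), which
    \<open>eq\<close> replaces by -4ab |Y|^2.\<close>
  define t where "t = complex_of_real (2 * a)"
  have t: "cnj t = t" "t * t = of_real (4 * a\<^sup>2)" by (simp_all add: t_def power2_eq_square)
  have "ip r (\<lambda>l. t * X l + G l) (\<lambda>l. t * X l + G l)
      = t * t * ip r X X + t * (ip r G X + cnj (ip r G X)) + ip r G G"
    unfolding cnj_ip by (simp add: ip_linear t(1) algebra_simps)
  then have "0 \<le> 4 * a\<^sup>2 * N + 4 * a * Re (ip r G X) + (\<Sum>j<m. \<Gamma> j * (cmod (\<eta> j))\<^sup>2)"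
    using ip_self_nonneg[of r "\<lambda>l. t * X l + G l"]
    unfolding complex_add_cnj GG XX t(2) by (simp add: t_def)
  also have "\<dots> = 4 * a * (a * N + Re (ip r G X)) + (\<Sum>j<m. \<Gamma> j * (cmod (\<eta> j))\<^sup>2)"
    by (simp add: power2_eq_square algebra_simps)
  also have "a * N + Re (ip r G X) = - b * (\<Sum>j<m. (cmod (\<eta> j))\<^sup>2)" using eq by simp
  finally have "0 \<le> 4 * a * (- b * (\<Sum>j<m. (cmod (\<eta> j))\<^sup>2)) + (\<Sum>j<m. \<Gamma> j * (cmod (\<eta> j))\<^sup>2)" .
  moreover have "(\<Sum>j<m. (4 * (a * b) - \<Gamma> j) * (cmod (\<eta> j))\<^sup>2)
      = 4 * (a * b) * (\<Sum>j<m. (cmod (\<eta> j))\<^sup>2) - (\<Sum>j<m. \<Gamma> j * (cmod (\<eta> j))\<^sup>2)"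
    by (simp only: sum_subtractf left_diff_distrib sum_distrib_left)
  ultimately have "(\<Sum>j<m. (4 * (a * b) - \<Gamma> j) * (cmod (\<eta> j))\<^sup>2) \<le> 0"
    by (simp add: algebra_simps)
  moreover have nn: "0 \<le> (4 * (a * b) - \<Gamma> j) * (cmod (\<eta> j))\<^sup>2" if "j < m" for j
    using \<eta>0[of j] \<Gamma>lt[of j] that by (cases "j < k - 1") auto
  ultimately have "(\<Sum>j<m. (4 * (a * b) - \<Gamma> j) * (cmod (\<eta> j))\<^sup>2) = 0"
    by (intro antisym sum_nonneg) auto
  then have "\<forall>j<m. (4 * (a * b) - \<Gamma> j) * (cmod (\<eta> j))\<^sup>2 = 0"
    using nn by (subst (asm) sum_nonneg_eq_0_iff) auto
  then have \<eta>: "\<eta> j = 0" if "j < m" for j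
    using \<eta>0[of j] \<Gamma>lt[of j] that by (cases "j < k - 1") force+
  then have "G = (\<lambda>l. 0)" "ip m Y Y = 0" by (simp_all add: G_def YY)
  moreover from this have "N = 0" using eq \<eta> a_neg by (simp add: ip_def)
  ultimately have "ip (r + m) X X = 0" unfolding ip_add XX Y_def[symmetric] by simp
  then show False using Xnz by simp
qed

end

section \<open>Reduction of the theorem to diagonal Gram data\<close>

lemma diagonalised_blockI:
  assumes C: "C \<in> carrier_mat r m" and D: "D \<in> carrier_mat m r" and U: "unitary_mat m U"
    and Z: "mat_adjoint U * (D * C) * U = mat_diag m z"
    and H: "mat_adjoint U * (mat_adjoint C * C + D * mat_adjoint D) * U = mat_diag m (\<lambda>i. of_real (h i))"
  shows "diagonalised_block r m (four_block_mat (\<alpha> \<cdot>\<^sub>m 1\<^sub>m r) C D (\<beta> \<cdot>\<^sub>m 1\<^sub>m m)) C D \<alpha> \<beta>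
    (\<lambda>j l. U $$ (l, j)) z h
    (\<lambda>j. app m C (\<lambda>l. U $$ (l, j))) (\<lambda>j. app m (mat_adjoint D) (\<lambda>l. U $$ (l, j)))"
proof
  note C' = adjoint_carrier[OF C] and D' = adjoint_carrier[OF D]
  have Uc: "U \<in> carrier_mat m m" and UU: "mat_adjoint U * U = 1\<^sub>m m" "U * mat_adjoint U = 1\<^sub>m m"
    using U by (auto simp: unitary_mat_def)
  define v where "v = (\<lambda>j l. U $$ (l, j))"
  \<comment> \<open>Entries of a conjugate by U are values of a sesquilinear form on the columns of
    U. Moving D and \<open>mat_adjoint C\<close> to the other argument turns those of Z and H into
    inner products of c and d.\<close>
  have quad: "(mat_adjoint U * M * U) $$ (i, j) = ip m (app m M (v j)) (v i)"
    if M: "M \<in> carrier_mat m m" and "i < m" "j < m" for M i j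
  proof -
    have "mat_adjoint U * M * U = mat_adjoint U * (M * U)"
      using adjoint_carrier[OF Uc] M Uc by (rule assoc_mult_mat)
    then show ?thesis using that Uc
      by (auto simp: adjoint_mult_index[OF Uc, of _ m] mult_index[OF M Uc] v_def app_def
          simp del: index_mult_mat intro!: ip_cong)
  qed
  show "ip m (\<lambda>l. U $$ (l, i)) (\<lambda>l. U $$ (l, j)) = (if i = j then 1 else 0)" if "i < m" "j < m" for i j
    using adjoint_mult_index[OF Uc Uc that(2,1)] that UU(1) by auto
  \<comment> \<open>Completeness of the columns is U U^* = 1, just as their orthonormality is U^* U
    = 1.\<close>
  show "y l = (\<Sum>j<m. ip m y (\<lambda>l. U $$ (l, j)) * U $$ (l, j))" if l: "l < m" for y l
  proof -
    have "y l = (\<Sum>l'<m. (U * mat_adjoint U) $$ (l, l') * y l')"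
      using l unfolding UU(2) by (simp add: if_distrib[of "\<lambda>t. t * _"] cong: if_cong)
    also have "\<dots> = (\<Sum>l'<m. \<Sum>j<m. U $$ (l, j) * cnj (U $$ (l', j)) * y l')"
      using l by (simp add: mult_index[OF Uc adjoint_carrier[OF Uc]] adjoint_index[OF Uc]
          sum_distrib_right del: index_mult_mat)
    also have "\<dots> = (\<Sum>j<m. \<Sum>l'<m. U $$ (l, j) * cnj (U $$ (l', j)) * y l')" by (rule sum.swap)
    also have "\<dots> = (\<Sum>j<m. ip m y (\<lambda>l. U $$ (l, j)) * U $$ (l, j))"
      unfolding ip_def sum_distrib_right by (simp add: mult_ac)
    finally show ?thesis .
  qed
  show "ip r (app m C (\<lambda>l. U $$ (l, j))) (app m (mat_adjoint D) (\<lambda>l. U $$ (l, i))) = (if i = j then z i else 0)"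
    if "i < m" "j < m" for i j
  proof -
    have "ip r (app m C (v j)) (app m (mat_adjoint D) (v i)) = ip m (app r D (app m C (v j))) (v i)"
      by (simp add: ip_app_adjoint[OF D])
    also have "\<dots> = ip m (app m (D * C) (v j)) (v i)"
      by (intro ip_cong) (simp_all add: app_mult[OF D C])
    also have "\<dots> = (if i = j then z i else 0)"
      using quad[of "D * C" i j] that C D Z by (auto simp: mat_diag_def)
    finally show ?thesis by (simp add: v_def)
  qed
  show "ip r (app m C (\<lambda>l. U $$ (l, j))) (app m C (\<lambda>l. U $$ (l, i)))
      + ip r (app m (mat_adjoint D) (\<lambda>l. U $$ (l, j))) (app m (mat_adjoint D) (\<lambda>l. U $$ (l, i)))
      = (if i = j then of_real (h i) else 0)"
    if "i < m" "j < m" for i j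
  proof -
    have "ip r (app m C (v j)) (app m C (v i)) + ip r (app m (mat_adjoint D) (v j)) (app m (mat_adjoint D) (v i))
      = ip m (app r (mat_adjoint C) (app m C (v j))) (v i) + ip m (app r D (app m (mat_adjoint D) (v j))) (v i)"
      by (simp add: ip_app_adjoint[OF D] ip_app_adjoint[OF C'] adjoint_adjoint[OF C])
    also have "\<dots> = ip m (app m (mat_adjoint C * C + D * mat_adjoint D) (v j)) (v i)"
      unfolding ip_linear_left[symmetric] using C D C' D'
      by (intro ip_cong) (simp_all add: app_add[where n = m] app_mult[OF D D'] app_mult[OF C' C])
    also have "\<dots> = (if i = j then of_real (h i) else 0)"
      using quad[of "mat_adjoint C * C + D * mat_adjoint D" i j] that C D C' D' H by (auto simp: mat_diag_def)
    finally show ?thesis by (simp add: v_def)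
  qed
qed (use C D in auto)

theorem corollary3p1:
  fixes r n :: nat and \<alpha> \<beta> :: complex and A C D Z H U :: "complex mat"
    and z :: "nat \<Rightarrow> complex" and h :: "nat \<Rightarrow> real"
    and \<Delta> :: "nat \<Rightarrow> complex" and E :: "nat \<Rightarrow> complex set"
  assumes "0 < r" and "r < n" and "n \<le> 2 * r"
    and "C \<in> carrier_mat r (n - r)" and "D \<in> carrier_mat (n - r) r"
    and "A = four_block_mat (\<alpha> \<cdot>\<^sub>m 1\<^sub>m r) C D (\<beta> \<cdot>\<^sub>m 1\<^sub>m (n - r))"
    and "Z = D * C" and "normal_mat Z"
    and "H = mat_adjoint C * C + D * mat_adjoint D" and "Z * H = H * Z"
    and "unitary_mat (n - r) U"
    and "mat_adjoint U * Z * U = mat_diag (n - r) (\<lambda>i. z (i + 1))"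
    and "mat_adjoint U * H * U = mat_diag (n - r) (\<lambda>i. complex_of_real (h (i + 1)))"
    and "\<And>j. j \<in> {1..n - r} \<Longrightarrow> \<Delta> j = (\<alpha> - \<beta>)\<^sup>2 + 4 * z j"
    and "\<And>j. j \<in> {1..n - r} \<Longrightarrow>
           E j = elliptical_disc ((\<alpha> + \<beta>) / 2 + csqrt (\<Delta> j) / 2) ((\<alpha> + \<beta>) / 2 - csqrt (\<Delta> j) / 2)
                   (sqrt ((cmod (\<alpha> - \<beta>))\<^sup>2 / 2 + h j + cmod (\<Delta> j) / 2))
                   (sqrt ((cmod (\<alpha> - \<beta>))\<^sup>2 / 2 + h j - cmod (\<Delta> j) / 2))"
    and "\<And>j. 1 \<le> j \<Longrightarrow> j < n - r \<Longrightarrow> E (j + 1) \<subseteq> E j"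
  shows "\<forall>k. 1 \<le> k \<and> k \<le> n - r \<longrightarrow> rank_numerical_range k A = E k"
proof (intro allI impI)
  fix k assume "1 \<le> k \<and> k \<le> n - r"
  then have k: "1 \<le> k" "k \<le> n - r" by auto
  define m where "m = n - r"
  have mr: "m \<le> r" using assms(3) by (simp add: m_def)
  \<comment> \<open>The locale counts from 0, hence the shift by one in z and h.\<close>
  interpret diagonalised_block r m A C D \<alpha> \<beta> "\<lambda>j l. U $$ (l, j)" "\<lambda>i. z (i + 1)" "\<lambda>i. h (i + 1)"
    "\<lambda>j. app m C (\<lambda>l. U $$ (l, j))" "\<lambda>j. app m (mat_adjoint D) (\<lambda>l. U $$ (l, j))"
    unfolding assms(6) m_def
    by (rule diagonalised_blockI) (use assms(4,5,7,9,11-13) in auto)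
  have zh: "2 * cmod (z j) \<le> h j" if "j \<in> {1..m}" for j
    using z_le_h[of "j - 1"] that by auto
  have mem: "\<mu> \<in> E j \<longleftrightarrow>
      2 * cmod ((\<alpha> - \<mu>) * (\<beta> - \<mu>) - z j) + 2 * Re ((\<alpha> - \<mu>) * cnj (\<beta> - \<mu>)) \<le> h j"
    if "j \<in> {1..m}" for j \<mu>
    using elliptical_disc_mem_iff[OF assms(14) zh] assms(15) that by (simp add: m_def)
  have nested: "E j \<subseteq> E i" if "i \<le> j" "1 \<le> i" "j \<le> m" for i j
    using that
  proof (induction j rule: dec_induct)
    case (step j)
    then show ?case using assms(16)[of j] by (auto simp: m_def)
  qed simp
  show "rank_numerical_range k A = E k"
  proof (intro equalityI subsetI)
    fix \<mu> assume \<mu>: "\<mu> \<in> E k"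
    show "\<mu> \<in> rank_numerical_range k A"
    proof (rule mem_rank_numerical_range_if)
      fix j assume "j < k"
      then have "\<mu> \<in> E (j + 1)" using nested[of "j + 1" k] \<mu> k by (auto simp: m_def)
      then show "2 * cmod ((\<alpha> - \<mu>) * (\<beta> - \<mu>) - z (j + 1)) + 2 * Re ((\<alpha> - \<mu>) * cnj (\<beta> - \<mu>)) \<le> h (j + 1)"
        using mem[of "j + 1"] \<open>j < k\<close> k by (simp add: m_def)
    qed (use k mr in \<open>auto simp: m_def\<close>)
  next
    fix \<mu> assume \<mu>: "\<mu> \<in> rank_numerical_range k A"
    show "\<mu> \<in> E k"
    proof (rule ccontr)
      assume "\<mu> \<notin> E k"
      then obtain \<epsilon> where \<epsilon>: "cmod \<epsilon> = 1"
        and neg: "Re (\<epsilon> * (\<alpha> - \<mu>)) + Re (\<epsilon> * (\<beta> - \<mu>)) \<le> 0"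
        and ltk: "h k + 2 * Re (\<epsilon>\<^sup>2 * z k) < 4 * (Re (\<epsilon> * (\<alpha> - \<mu>)) * Re (\<epsilon> * (\<beta> - \<mu>)))"
        using outside_disc_direction[of "h k" \<alpha> \<mu> \<beta> "z k"] mem[of k \<mu>] k by (auto simp: m_def)
      define a b where "a = Re (\<epsilon> * (\<alpha> - \<mu>))" and "b = Re (\<epsilon> * (\<beta> - \<mu>))"
      \<comment> \<open>The direction found for E_k must also work for each E_j inside it. If it
        failed, the support point w of E_j would satisfy x = Re (\<epsilon> (w - \<mu>)) \<ge> 0.
        But w lies in E_k, and passing from \<mu> to w turns a and b into a - x and b - x, whose
        product is at least ab because a + b \<le> 0. This contradicts \<open>ltk\<close>.\<close>
      have "h j + 2 * Re (\<epsilon>\<^sup>2 * z j) < 4 * (a * b)" if j: "k \<le> j" "j \<le> m" for j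
      proof (rule ccontr)
        assume "\<not> ?thesis"
        then have ge: "4 * (a * b) \<le> h j + 2 * Re (\<epsilon>\<^sup>2 * z j)" by simp
        have jm: "j \<in> {1..m}" using j k by simp
        obtain w where w: "w \<in> E j" and
          sup: "Re (\<epsilon> * (w - (\<alpha> + \<beta>) / 2)) = sqrt ((Re (\<epsilon> * (\<alpha> - \<beta>)))\<^sup>2 + h j + 2 * Re (\<epsilon>\<^sup>2 * z j)) / 2"
          using elliptical_disc_support_point[OF assms(14) zh \<epsilon>, of j] assms(15)[of j] jm
          by (auto simp: m_def)
        define x where "x = Re (\<epsilon> * (w - \<mu>))"
        have ab: "Re (\<epsilon> * (\<alpha> - \<beta>)) = a - b" by (simp add: a_def b_def algebra_simps)
        \<comment> \<open>By (a + b)^2 = (a - b)^2 + 4ab, the assumed bound on 4ab becomes a lower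
          bound for the support value.\<close>
        have "(- (a + b))\<^sup>2 \<le> (a - b)\<^sup>2 + h j + 2 * Re (\<epsilon>\<^sup>2 * z j)"
          using ge by (simp add: power2_eq_square algebra_simps)
        then have "- (a + b) \<le> sqrt ((a - b)\<^sup>2 + h j + 2 * Re (\<epsilon>\<^sup>2 * z j))"
          by (rule real_le_rsqrt)
        moreover have "\<epsilon> * (w - \<mu>) = \<epsilon> * (w - (\<alpha> + \<beta>) / 2) + (\<epsilon> * (\<alpha> - \<mu>) + \<epsilon> * (\<beta> - \<mu>)) / 2"
          by (simp add: field_simps)
        then have "x = Re (\<epsilon> * (w - (\<alpha> + \<beta>) / 2)) + (a + b) / 2"
          unfolding x_def a_def b_def by (simp del: times_complex.sel)
        ultimately have x: "0 \<le> x" using sup unfolding ab by argo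
        have "w \<in> E k" using w nested[OF j(1)] k j by auto
        then have "4 * (Re (\<epsilon> * (\<alpha> - w)) * Re (\<epsilon> * (\<beta> - w))) \<le> h k + 2 * Re (\<epsilon>\<^sup>2 * z k)"
          using Re_product_le_if_mem[OF _ \<epsilon>] mem[of k w] k by (auto simp: m_def)
        moreover have "Re (\<epsilon> * (\<alpha> - w)) = a - x" "Re (\<epsilon> * (\<beta> - w)) = b - x"
          by (simp_all add: a_def b_def x_def algebra_simps)
        ultimately have "4 * ((a - x) * (b - x)) < 4 * (a * b)" using ltk by (simp add: a_def b_def)
        moreover have "(a - x) * (b - x) = a * b + (x * x + x * - (a + b))" by (simp add: algebra_simps)
        moreover have "0 \<le> x * - (a + b)"
          using x neg by (intro mult_nonneg_nonneg) (auto simp: a_def b_def)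
        moreover have "0 \<le> x * x" by simp
        ultimately show False by linarith
      qed
      then have "\<mu> \<notin> rank_numerical_range k A"
        using k by (intro not_mem_rank_numerical_range[OF _ _ \<epsilon> neg]) (auto simp: m_def a_def b_def)
      then show False using \<mu> by blast
    qed
  qed
qed

end
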